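(* Let $X_1,\dots,X_n$ be i.i.d. with distribution $P_{\theta_0}$, $\theta_0\in\Theta$, let $\pi$ be a prior on $\Theta$, fix $\mathcal{F}\subset\mathcal{M}_1^+(\Theta)$ and let $\alpha\in(0,1)$. Then $$\mathbb{E} \left[ \int D_{\alpha}(P_{\theta},P_{\theta_0})\, \tilde{\pi}_{n,\alpha}(\mathrm{d}\theta|X_1^n) \right] \leq \inf_{\rho\in\mathcal{F}} \left\{ \frac{\alpha}{1-\alpha} \int \mathcal{K}(P_{\theta_0},P_{\theta})\, \rho(\mathrm{d}\theta) + \frac{\mathcal{K}(\rho,\pi)}{n(1-\alpha)} \right\}.$$ Moreover, if $\varepsilon_n>0$ is such that there is a distribution $\rho_n\in\mathcal{F}$ with $$\int \mathcal{K}(P_{\theta_0},P_{\theta})\, \rho_n(\mathrm{d}\theta) \leq\varepsilon_n \quad\text{and}\quad \mathcal{K}(\rho_n,\pi) \leq n\varepsilon_n,$$ then, for any $\alpha\in(0,1)$, $$\mathbb{E} \left[ \int D_{\alpha}(P_{\theta},P_{\theta_0})\, \tilde{\pi}_{n,\alpha}(\mathrm{d}\theta|X_1^n) \right] \leq \frac{1+\alpha}{1-\alpha}\,\varepsilon_n .$$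
   Context: $\{P_\theta:\theta\in\Theta\}$ is a statistical model dominated by a measure $Q$, with densities $p_\theta=\mathrm{d}P_\theta/\mathrm{d}Q$. $\Theta$ carries a $\sigma$-algebra and $\mathcal{M}_1^+(\Theta)$ is the set of all probability measures on $\Theta$. $\mathbb{E}$ is the expectation under $\mathbb{P}=P_{\theta_0}^{\otimes n}$, the law of $X_1^n=(X_1,\dots,X_n)$. $r_n(\theta,\theta')=\sum_{i=1}^n\log\frac{p_{\theta'}(X_i)}{p_\theta(X_i)}$; $(X_1^n,\theta)\mapsto r_n(\theta,\theta_0)$ is assumed jointly measurable (and the regularity needed for the quantities involved to be measurable is implicitly assumed). $D_\alpha(P,R)=\frac{1}{\alpha-1}\log\int\left(\frac{\mathrm{d}P}{\mathrm{d}\mu}\right)^\alpha\left(\frac{\mathrm{d}R}{\mathrm{d}\mu}\right)^{1-\alpha}\mathrm{d}\mu$ for any $\mu$ dominating $P,R$. $\mathcal{K}(P,R)=\int\log\frac{\mathrm{d}P}{\mathrm{d}R}\,\mathrm{d}P$ if $P\ll R$, $+\infty$ otherwise. Tempered posterior: $\pi_{n,\alpha}(\mathrm{d}\theta|X_1^n)\propto e^{-\alpha r_n(\theta,\theta_0)}\pi(\mathrm{d}\theta)\propto\left(\prod_i p_\theta(X_i)\right)^\alpha\pi(\mathrm{d}\theta)$. Variational approximation: $\tilde\pi_{n,\alpha}(\cdot|X_1^n)=\arg\min_{\rho\in\mathcal{F}}\mathcal{K}(\rho,\pi_{n,\alpha}(\cdot|X_1^n))$, equivalently $\tilde\pi_{n,\alpha}(\cdot|X_1^n)=\arg\min_{\rho\in\mathcal{F}}\left\{\alpha\int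 r_n(\theta,\theta_0)\rho(\mathrm{d}\theta)+\mathcal{K}(\rho,\pi)\right\}$; a minimizer is assumed to exist and $\tilde\pi_{n,\alpha}$ denotes any such minimizer. (An indeterminate $\infty-\infty$ value of $\alpha\int r_n\mathrm{d}\rho+\mathcal{K}(\rho,\pi)$ is read as $+\infty$.) *)

theory Defs
  imports "HOL-Probability.Probability"
begin

definition eln :: "ennreal \<Rightarrow> ereal" where
  "eln x = (if x = 0 then - \<infinity> else if x = \<infinity> then \<infinity> else ereal (ln (enn2real x)))"

text \<open>Integral of an extended-real function, positive part minus negative part.  As
  \<^term>\<open>\<infinity> - \<infinity> = (\<infinity> :: ereal)\<close>, an indeterminate integral has the value \<^term>\<open>\<infinity> :: ereal\<close>,
  and likewise an indeterminate sum of two extended reals.\<close>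

definition eintegral :: "'a measure \<Rightarrow> ('a \<Rightarrow> ereal) \<Rightarrow> ereal" where
  "eintegral M f =
     enn2ereal (\<integral>\<^sup>+ x. e2ennreal (f x) \<partial>M) - enn2ereal (\<integral>\<^sup>+ x. e2ennreal (- f x) \<partial>M)"

text \<open>The Kullback--Leibler divergence of \<open>P\<close> from \<open>R\<close>.  The library's
  \<^const>\<open>KL_divergence\<close> (with the reference measure as its first measure argument) is a real
  Bochner integral, which is \<open>0\<close> when the log-density is not \<open>P\<close>-integrable.  For probability
  measures its negative part is always integrable, so the value is then \<open>\<infinity>\<close>.\<close>

definition KL :: "'a measure \<Rightarrow> 'a measure \<Rightarrow> ereal" where
  "KL P R =
     (if absolutely_continuous R P \<and> integrable P (entropy_density (exp 1) R P)
      then ereal (KL_divergence (exp 1) R P) else \<infinity>)"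

text \<open>The Renyi divergence of order \<open>\<alpha> \<in> (0,1)\<close>, computed with densities with respect to a
  measure \<open>\<mu>\<close> that dominates \<open>P\<close> and \<open>R\<close>; the value does not depend on \<open>\<mu>\<close>.  (For \<open>\<alpha> > 1\<close>
  the convention \<^term>\<open>0 powr a = (0 :: real)\<close> would make it incorrect.)\<close>

definition renyi_divergence ::
  "real \<Rightarrow> 'a measure \<Rightarrow> 'a measure \<Rightarrow> 'a measure \<Rightarrow> ereal" where
  "renyi_divergence \<alpha> \<mu> P R =
     ereal (1 / (\<alpha> - 1)) *
     eln (\<integral>\<^sup>+ x. ennreal (enn2real (RN_deriv \<mu> P x) powr \<alpha> *
                         enn2real (RN_deriv \<mu> R x) powr (1 - \<alpha>)) \<partial>\<mu>)"

text \<open>The value is \<open>\<infinity>\<close> if \<open>p \<theta>\<close> vanishes at an observation where \<open>p \<theta>'\<close> is positive.\<close>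

definition log_lik_ratio ::
  "nat \<Rightarrow> ('t \<Rightarrow> 'a \<Rightarrow> real) \<Rightarrow> 't \<Rightarrow> 't \<Rightarrow> (nat \<Rightarrow> 'a) \<Rightarrow> ereal" where
  "log_lik_ratio n p \<theta> \<theta>' x = (\<Sum>i = 1..n. eln (ennreal (p \<theta>' (x i)) / ennreal (p \<theta> (x i))))"

definition tempered_posterior ::
  "nat \<Rightarrow> real \<Rightarrow> ('t \<Rightarrow> 'a \<Rightarrow> real) \<Rightarrow> 't measure \<Rightarrow> (nat \<Rightarrow> 'a) \<Rightarrow> 't measure" where
  "tempered_posterior n \<alpha> p \<pi> x =
     density \<pi> (\<lambda>\<theta>. ennreal ((\<Prod>i = 1..n. p \<theta> (x i)) powr \<alpha>) /
                    (\<integral>\<^sup>+ \<theta>'. ennreal ((\<Prod>i = 1..n. p \<theta>' (x i)) powr \<alpha>) \<partial>\<pi>))"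

text \<open>A variational approximation of the tempered posterior within \<open>F\<close>.  The two objectives
  differ by a constant (the log of the normalising constant) except at those \<open>\<rho>\<close> where the second
  one is indeterminate and hence read as \<open>\<infinity>\<close>.  A minimiser of either is admitted.\<close>

definition variational_approximation ::
  "nat \<Rightarrow> real \<Rightarrow> ('t \<Rightarrow> 'a \<Rightarrow> real) \<Rightarrow> 't \<Rightarrow> 't measure \<Rightarrow> 't measure set \<Rightarrow>
   (nat \<Rightarrow> 'a) \<Rightarrow> 't measure \<Rightarrow> bool" where
  "variational_approximation n \<alpha> p \<theta>\<^sub>0 \<pi> F x \<rho> \<longleftrightarrow>
     is_arg_min (\<lambda>\<rho>. KL \<rho> (tempered_posterior n \<alpha> p \<pi> x)) (\<lambda>\<rho>. \<rho> \<in> F) \<rho> \<or>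
     is_arg_min (\<lambda>\<rho>. ereal \<alpha> * eintegral \<rho> (\<lambda>\<theta>. log_lik_ratio n p \<theta> \<theta>\<^sub>0 x) + KL \<rho> \<pi>)
       (\<lambda>\<rho>. \<rho> \<in> F) \<rho>"

end

(* The weights w = exp (- \<alpha> r_n) satisfy E[w(\<theta>)] = B(\<theta>) = exp (- n (1 - \<alpha>) D_\<alpha>(P_\<theta>, P_\<theta>\<^sub>0)), so by Fubini
   Y = \<integral> w / B d\<pi> has E[Y] \<le> 1.  Donsker--Varadhan with respect to the tempered posterior bounds
   n (1 - \<alpha>) \<integral> D_\<alpha> d\<rho>' by KL(\<rho>', \<pi>_n) + ln (Y / Z), where Z = \<integral> w d\<pi> is the normalising constant.
   At the minimiser, KL(\<rho>', \<pi>_n) is at most KL(\<rho>, \<pi>_n) = \<alpha> \<integral> r_n d\<rho> + KL(\<rho>, \<pi>) + ln Z for each fixed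
   \<rho> in F, so Z cancels; ln Y \<le> Y - 1 and Fubini for E \<integral> r_n d\<rho> then give the bound.  The
   inequality is carried in ennreal with positive and negative parts on opposite sides, and it does
   not require \<theta> \<mapsto> KL(P_\<theta>\<^sub>0, P_\<theta>) to be measurable. *)

theory Submission
  imports Defs
begin

text \<open>The obstacle is that \<open>\<rho>'\<close> depends on the sample. Donsker--Varadhan
  bounds all candidates for \<open>\<rho>'\<close> by the same quantity Y, so the data enter only
  through the value of one integral against \<open>\<rho>'\<close>, while Fubini is applied only to
  the fixed measures \<open>\<pi>\<close> and \<open>\<rho>\<close>. The condition \<alpha> < 1 acts
  through B \<le> 1, a consequence of Young's inequality. It gives Z \<le> Y, so that E[Y] \<le> 1
  also makes Z finite almost surely. It further gives \<alpha> E[r_n^-] \<le> E[w] \<le> 1, by t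
  \<le> exp t. This bound on the negative part is uniform in \<theta>, and it is what allows the
  negative part of the empirical term to be cancelled after taking expectations. Where P_\<theta>
  and the true distribution are mutually singular, B = 0 and the Renyi divergence is infinite.
  Finiteness of Y forces w = 0 there up to a \<open>\<pi>\<close>-null set, so a minimiser of finite
  divergence puts no mass on such \<theta>.\<close>

section \<open>Kullback--Leibler divergence: densities, Donsker--Varadhan, change of base
  measure\<close>

text \<open>By uniqueness of Radon--Nikodym derivatives \<open>f\<close> agrees with the derivative
  wherever it is positive, and the set where \<open>f\<close> is not positive has no mass under the
  density measure.\<close>

lemma KL_density_eq:
  fixes f :: "'a \<Rightarrow> real"
  assumes "sigma_finite_measure M" and [measurable]: "f \<in> borel_measurable M"
  shows "KL (density M f) M =
    (if integrable (density M f) (\<lambda>x. ln (f x)) then ereal (\<integral>x. ln (f x) \<partial>density M f) else \<infinity>)"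
proof -
  interpret sigma_finite_measure M by fact
  let ?N = "density M (\<lambda>x. ennreal (f x))"
  have "AE x in M. ennreal (f x) = RN_deriv M ?N x"
    by (rule RN_deriv_unique) auto
  then have *: "AE x in ?N. entropy_density (exp 1) M ?N x = ln (f x)"
    by (subst AE_density) (auto simp: entropy_density_def log_def elim!: eventually_mono dest: sym)
  have "absolutely_continuous M ?N"
    by (rule absolutely_continuousI_density) simp
  moreover have "integrable ?N (entropy_density (exp 1) M ?N) \<longleftrightarrow> integrable ?N (\<lambda>x. ln (f x))"
    using * by (intro integrable_cong_AE) auto
  moreover have "KL_divergence (exp 1) M ?N = (\<integral>x. ln (f x) \<partial>?N)"
    unfolding KL_divergence_def using * by (intro integral_cong_AE) auto
  ultimately show ?thesis by (simp add: KL_def)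
qed

text \<open>Replaces the Radon--Nikodym derivative by a real density that is positive
  \<open>N\<close>-almost everywhere, so that logarithms of products and quotients can be split in
  what follows.\<close>

lemma KL_finiteE:
  assumes "prob_space M" "prob_space N" and sets: "sets N = sets M" and fin: "KL N M \<noteq> \<infinity>"
  obtains f where "f \<in> borel_measurable M" and "N = density M (\<lambda>x. ennreal (f x))"
    and "AE x in N. 0 < f x" and "integrable N (\<lambda>x. ln (f x))" and "KL N M = ereal (\<integral>x. ln (f x) \<partial>N)"
proof -
  interpret M: prob_space M by fact
  interpret N: prob_space N by fact
  have ac: "absolutely_continuous M N" using fin by (auto simp: KL_def split: if_splits)
  obtain f where f: "f \<in> borel_measurable M" "AE x in M. RN_deriv M N x = ennreal (f x)"
    "AE x in N. 0 < f x"
    using M.real_RN_deriv[OF N.finite_measure_axioms ac sets] by metis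
  have "density M (RN_deriv M N) = N"
    using ac sets by (rule M.density_RN_deriv)
  moreover have "density M (RN_deriv M N) = density M (\<lambda>x. ennreal (f x))"
    using f by (intro density_cong) auto
  ultimately have N: "N = density M (\<lambda>x. ennreal (f x))" by simp
  have *: "KL N M = (if integrable N (\<lambda>x. ln (f x)) then ereal (\<integral>x. ln (f x) \<partial>N) else \<infinity>)"
    using KL_density_eq[OF M.sigma_finite_measure_axioms f(1)] N by simp
  show thesis
    using that[OF f(1) N f(3)] * fin by (auto split: if_splits)
qed

text \<open>The factor \<open>f x\<close> cancels only where it is positive. Elsewhere the left
  integrand is \<open>0\<close>, and the mass of \<open>g\<close> on that set is lost; hence an
  inequality.\<close>

lemma nn_integral_density_inverse_le:
  fixes f g :: "'a \<Rightarrow> real"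
  assumes [measurable]: "f \<in> borel_measurable M" "g \<in> borel_measurable M"
  shows "(\<integral>\<^sup>+x. ennreal (g x / f x) \<partial>density M f) \<le> (\<integral>\<^sup>+x. ennreal (g x) \<partial>M)"
proof -
  have "ennreal (f x) * ennreal (g x / f x) \<le> ennreal (g x)" for x
    by (cases "0 < f x") (auto simp: ennreal_mult'[symmetric] ennreal_neg)
  then show ?thesis
    by (subst nn_integral_density) (auto intro!: nn_integral_mono)
qed

text \<open>Donsker--Varadhan, from \<open>ln t \<le> t - 1\<close> at \<open>t = exp u / (c f)\<close>.\<close>

lemma Donsker_Varadhan_le:
  fixes u :: "'a \<Rightarrow> real"
  assumes "prob_space M" "prob_space N" and sets: "sets N = sets M" and fin: "KL N M \<noteq> \<infinity>"
    and [measurable]: "u \<in> borel_measurable M" and u0: "\<And>x. 0 \<le> u x"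
    and c: "0 < c" "(\<integral>\<^sup>+x. ennreal (exp (u x)) \<partial>M) \<le> ennreal c"
  shows "integrable N u" and "ereal (\<integral>x. u x \<partial>N) \<le> KL N M + ereal (ln c)"
proof -
  interpret N: prob_space N by fact
  obtain f where f[measurable]: "f \<in> borel_measurable M" and N: "N = density M (\<lambda>x. ennreal (f x))"
    and pos: "AE x in N. 0 < f x" and int: "integrable N (\<lambda>x. ln (f x))"
    and KL: "KL N M = ereal (\<integral>x. ln (f x) \<partial>N)"
    using KL_finiteE[OF assms(1-4)] by blast
  have [measurable]: "f \<in> borel_measurable N" "u \<in> borel_measurable N"
    by (simp_all add: N)
  define h where "h x = exp (u x) / c / f x" for x
  have [measurable]: "h \<in> borel_measurable N" unfolding h_def by measurable
  have "(\<integral>\<^sup>+x. ennreal (h x) \<partial>N) \<le> (\<integral>\<^sup>+x. ennreal (exp (u x) / c) \<partial>M)"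
    unfolding N h_def by (rule nn_integral_density_inverse_le) auto
  also have "\<dots> = (\<integral>\<^sup>+x. ennreal (exp (u x)) \<partial>M) * ennreal (1 / c)"
    using c by (subst nn_integral_multc[symmetric]) (auto simp: ennreal_mult'[symmetric])
  also have "\<dots> \<le> ennreal c * ennreal (1 / c)"
    using c by (intro mult_right_mono) auto
  finally have h1: "(\<integral>\<^sup>+x. ennreal (h x) \<partial>N) \<le> 1"
    using c by (simp add: ennreal_mult'[symmetric])
  have h0: "AE x in N. 0 \<le> h x" using pos c by (auto simp: h_def)
  have ih: "integrable N h"
    using h0 h1 by (intro integrableI_nonneg) (auto intro: le_less_trans)
  have "ennreal (\<integral>x. h x \<partial>N) \<le> 1"
    using h1 nn_integral_eq_integral[OF ih h0] by simp
  then have Ih: "(\<integral>x. h x \<partial>N) \<le> 1" by simp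
  have le: "AE x in N. u x \<le> ln (f x) + ln c + h x - 1"
    using pos
  proof eventually_elim
    case (elim x)
    then have "ln (h x) = u x - ln c - ln (f x)"
      using c by (simp add: h_def ln_div ln_mult)
    moreover have "ln (h x) \<le> h x - 1"
      using elim c by (intro ln_le_minus_one) (simp add: h_def)
    ultimately show ?case by simp
  qed
  have ib: "integrable N (\<lambda>x. ln (f x) + ln c + h x - 1)"
    using int ih by simp
  \<comment> \<open>Since \<open>u\<close> is nonnegative, the integrable upper bound in
    \<open>le\<close> alone gives integrability.\<close>
  show iu: "integrable N u"
    using le u0 by (intro Bochner_Integration.integrable_bound[OF ib]) auto
  have "(\<integral>x. u x \<partial>N) \<le> (\<integral>x. ln (f x) + ln c + h x - 1 \<partial>N)"
    using iu ib le by (rule integral_mono_AE)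
  also have "\<dots> = (\<integral>x. ln (f x) \<partial>N) + ln c + (\<integral>x. h x \<partial>N) - 1"
    using int ih by (simp add: N.prob_space)
  finally show "ereal (\<integral>x. u x \<partial>N) \<le> KL N M + ereal (ln c)"
    using Ih by (simp add: KL)
qed

lemma KL_nonneg:
  assumes "prob_space M" "prob_space N" "sets N = sets M"
  shows "0 \<le> KL N M"
proof (cases "KL N M = \<infinity>")
  case False
  then show ?thesis
    using Donsker_Varadhan_le(2)[OF assms False, of "\<lambda>_. 0" 1] prob_space.emeasure_space_1[OF assms(1)]
    by (simp add: zero_ereal_def)
qed simp

text \<open>The integrability of \<open>ln g\<close> comes from \<open>ln g \<le> ln f + g / f\<close> with \<open>f\<close> the density of \<open>N\<close>
  with respect to \<open>M\<close>.\<close>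

lemma KL_change_base:
  fixes g :: "'a \<Rightarrow> real"
  assumes "prob_space M" "prob_space N" and sets: "sets N = sets M" and fin: "KL N M \<noteq> \<infinity>"
    and g[measurable]: "g \<in> borel_measurable M" and "prob_space (density M (\<lambda>x. ennreal (g x)))"
    and gpos: "AE x in N. 0 < g x" and gfin: "(\<integral>\<^sup>+x. ennreal (- ln (g x)) \<partial>N) < \<infinity>"
  shows "integrable N (\<lambda>x. ln (g x))"
    and "KL N (density M (\<lambda>x. ennreal (g x))) = KL N M - ereal (\<integral>x. ln (g x) \<partial>N)"
proof -
  interpret N: prob_space N by fact
  let ?M = "density M (\<lambda>x. ennreal (g x))"
  interpret M': prob_space ?M by fact
  obtain f where f[measurable]: "f \<in> borel_measurable M" and N: "N = density M (\<lambda>x. ennreal (f x))"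
    and pos: "AE x in N. 0 < f x" and int: "integrable N (\<lambda>x. ln (f x))"
    and KL: "KL N M = ereal (\<integral>x. ln (f x) \<partial>N)"
    using KL_finiteE[OF assms(1-4)] by blast
  have mN[measurable_cong]: "sets N = sets M" by fact
  have "(\<integral>\<^sup>+x. ennreal (g x) \<partial>M) = 1"
    using M'.emeasure_space_1 by (simp add: emeasure_density cong: nn_integral_cong)
  then have q1: "(\<integral>\<^sup>+x. ennreal (g x / f x) \<partial>N) \<le> 1"
    using nn_integral_density_inverse_le[OF f g] by (simp add: N)
  have q0: "AE x in N. 0 \<le> g x / f x" using gpos pos by eventually_elim simp
  have iq: "integrable N (\<lambda>x. g x / f x)"
    using q0 q1 by (intro integrableI_nonneg) (auto intro: le_less_trans)
  have "(\<integral>\<^sup>+x. ennreal (max 0 (- ln (g x))) \<partial>N) = (\<integral>\<^sup>+x. ennreal (- ln (g x)) \<partial>N)"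
    by (intro nn_integral_cong) (simp add: max_def ennreal_neg)
  then have im: "integrable N (\<lambda>x. max 0 (- ln (g x)))"
    using gfin by (intro integrableI_nonneg) simp_all
  have b: "AE x in N. \<bar>ln (g x)\<bar> \<le> \<bar>ln (f x)\<bar> + g x / f x + max 0 (- ln (g x))"
    using gpos pos
  proof eventually_elim
    case (elim x)
    then have "ln (g x) - ln (f x) \<le> g x / f x - 1"
      using ln_le_minus_one[of "g x / f x"] by (simp add: ln_div)
    moreover have "0 < g x / f x" using elim by simp
    ultimately show ?case by linarith
  qed
  show ig: "integrable N (\<lambda>x. ln (g x))"
  proof (rule Bochner_Integration.integrable_bound)
    show "integrable N (\<lambda>x. \<bar>ln (f x)\<bar> + g x / f x + max 0 (- ln (g x)))"
      using int iq im by (intro Bochner_Integration.integrable_add integrable_abs)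
    show "AE x in N. norm (ln (g x)) \<le> norm (\<bar>ln (f x)\<bar> + g x / f x + max 0 (- ln (g x)))"
      using b by eventually_elim (metis abs_ge_self order_trans real_norm_def)
  qed simp
  \<comment> \<open>The hypothesis \<open>gpos\<close> holds almost everywhere under
    \<open>N\<close>, that is, \<open>M\<close>-almost everywhere on the set where \<open>f\<close>
    is positive. This makes \<open>f / g\<close> a density of \<open>N\<close> with respect to the
    new base.\<close>
  have fg: "AE x in M. ennreal (g x) * ennreal (f x / g x) = ennreal (f x)"
  proof -
    have "AE x in M. 0 < f x \<longrightarrow> 0 < g x"
      using gpos unfolding N by (subst (asm) AE_density) auto
    then show ?thesis
    proof eventually_elim
      case (elim x)
      then show ?case
        by (cases "0 < f x"; cases "0 < g x")
          (auto simp: ennreal_mult'[symmetric] ennreal_neg divide_le_0_iff not_less)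
    qed
  qed
  have "density ?M (\<lambda>x. ennreal (f x / g x)) = density M (\<lambda>x. ennreal (g x) * ennreal (f x / g x))"
    by (rule density_density_eq) auto
  also have "\<dots> = N"
    unfolding N using fg by (intro density_cong) auto
  finally have N': "N = density ?M (\<lambda>x. ennreal (f x / g x))" ..
  have eq: "AE x in N. ln (f x / g x) = ln (f x) - ln (g x)"
    using gpos pos by eventually_elim (simp add: ln_div)
  have "integrable N (\<lambda>x. ln (f x / g x)) \<longleftrightarrow> integrable N (\<lambda>x. ln (f x) - ln (g x))"
    using eq by (intro integrable_cong_AE) auto
  then have i: "integrable N (\<lambda>x. ln (f x / g x))" using int ig by simp
  have "(\<integral>x. ln (f x / g x) \<partial>N) = (\<integral>x. ln (f x) - ln (g x) \<partial>N)"
    using eq by (intro integral_cong_AE) auto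
  then have e: "(\<integral>x. ln (f x / g x) \<partial>N) = (\<integral>x. ln (f x) \<partial>N) - (\<integral>x. ln (g x) \<partial>N)"
    using int ig by simp
  have "KL N ?M = ereal (\<integral>x. ln (f x / g x) \<partial>N)"
    using KL_density_eq[OF M'.sigma_finite_measure_axioms, of "\<lambda>x. f x / g x"] i by (simp flip: N')
  then show "KL N ?M = KL N M - ereal (\<integral>x. ln (g x) \<partial>N)"
    by (simp add: e KL)
qed

section \<open>Extended-real integrals and exponential weights\<close>

text \<open>Junk value: \<open>exp_neg \<alpha> (-\<infinity>) = 1\<close>.  Almost surely the log-likelihood ratio is not \<open>-\<infinity>\<close>.\<close>

definition exp_neg :: "real \<Rightarrow> ereal \<Rightarrow> ennreal" where
  "exp_neg \<alpha> r = (if r = \<infinity> then 0 else ennreal (exp (- (\<alpha> * real_of_ereal r))))"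

lemma measurable_exp_neg[measurable]: "exp_neg \<alpha> \<in> borel_measurable borel"
  unfolding exp_neg_def by measurable

lemma measurable_eln[measurable]: "eln \<in> borel_measurable borel"
  unfolding eln_def by measurable

lemma eintegral_eq_integral:
  assumes int: "integrable M R" and eq: "AE x in M. f x = ereal (R x)"
  shows "eintegral M f = ereal (\<integral>x. R x \<partial>M)"
    and "(\<integral>\<^sup>+x. e2ennreal (f x) \<partial>M) < \<infinity>" and "(\<integral>\<^sup>+x. e2ennreal (- f x) \<partial>M) < \<infinity>"
proof -
  have p: "(\<integral>\<^sup>+x. e2ennreal (f x) \<partial>M) = (\<integral>\<^sup>+x. ennreal (R x) \<partial>M)"
    by (rule nn_integral_cong_AE) (use eq in \<open>eventually_elim, simp\<close>)
  have n: "(\<integral>\<^sup>+x. e2ennreal (- f x) \<partial>M) = (\<integral>\<^sup>+x. ennreal (- R x) \<partial>M)"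
    by (rule nn_integral_cong_AE) (use eq in \<open>eventually_elim, simp\<close>)
  have fp: "(\<integral>\<^sup>+x. ennreal (R x) \<partial>M) < \<infinity>" and fn: "(\<integral>\<^sup>+x. ennreal (- R x) \<partial>M) < \<infinity>"
    using int by (simp_all add: real_integrable_def less_top)
  show "(\<integral>\<^sup>+x. e2ennreal (f x) \<partial>M) < \<infinity>" "(\<integral>\<^sup>+x. e2ennreal (- f x) \<partial>M) < \<infinity>"
    using fp fn by (simp_all add: p n)
  show "eintegral M f = ereal (\<integral>x. R x \<partial>M)"
    using fp fn unfolding eintegral_def p n real_lebesgue_integral_def[OF int]
    by (cases "\<integral>\<^sup>+x. ennreal (R x) \<partial>M"; cases "\<integral>\<^sup>+x. ennreal (- R x) \<partial>M") (auto simp: enn2ereal_ennreal)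
qed

text \<open>Rests on \<infinity> - \<infinity> = \<infinity>: an infinite positive part makes the
  value \<infinity> whatever the negative part is.\<close>

lemma eintegral_finiteD:
  assumes "eintegral M f \<noteq> \<infinity>"
  shows "(\<integral>\<^sup>+x. e2ennreal (f x) \<partial>M) < \<infinity>"
  using assms unfolding eintegral_def
  by (cases "\<integral>\<^sup>+x. e2ennreal (f x) \<partial>M") auto

lemma AE_KL_finite:
  assumes "prob_space M" "prob_space N" "sets N = sets M" "KL N M \<noteq> \<infinity>" and P: "AE x in M. P x"
  shows "AE x in N. P x"
proof -
  obtain f where f[measurable]: "f \<in> borel_measurable M" and N: "N = density M (\<lambda>x. ennreal (f x))"
    using KL_finiteE[OF assms(1-4)] by blast
  show ?thesis unfolding N using P by (subst AE_density) auto
qed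

section \<open>Exponentially tilted measures and their variational minimisers\<close>

text \<open>The Gibbs variational identity, obtained from \<open>KL_change_base\<close> with the
  normalised weight as density, whose logarithm is - \<alpha> G - ln Z. It shows that the two
  objectives differ by the constant ln Z at every \<open>\<rho>\<close> where neither term of the
  second one is \<infinity>. Integrability of the negative part of \<open>G\<close> is a conclusion
  here, not a hypothesis.\<close>

lemma KL_tempered:
  assumes "prob_space \<pi>" "prob_space \<rho>" and sets: "sets \<rho> = sets \<pi>"
    and G[measurable]: "G \<in> borel_measurable \<pi>" and G_mi: "\<And>\<theta>. \<theta> \<in> space \<pi> \<Longrightarrow> G \<theta> \<noteq> -\<infinity>"
    and \<alpha>: "0 < \<alpha>" and Z: "Z = (\<integral>\<^sup>+\<theta>. exp_neg \<alpha> (G \<theta>) \<partial>\<pi>)" and Z_fin: "Z < \<infinity>"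
    and KL_fin: "KL \<rho> \<pi> \<noteq> \<infinity>" and G_fin: "eintegral \<rho> G \<noteq> \<infinity>"
  shows "0 < Z" and "prob_space (density \<pi> (\<lambda>\<theta>. exp_neg \<alpha> (G \<theta>) / Z))"
    and "(\<integral>\<^sup>+\<theta>. e2ennreal (- G \<theta>) \<partial>\<rho>) < \<infinity>"
    and "KL \<rho> (density \<pi> (\<lambda>\<theta>. exp_neg \<alpha> (G \<theta>) / Z)) =
      ereal \<alpha> * eintegral \<rho> G + KL \<rho> \<pi> + ereal (ln (enn2real Z))"
proof -
  interpret \<rho>: prob_space \<rho> by fact
  have [measurable_cong]: "sets \<rho> = sets \<pi>" by fact
  have sp: "space \<rho> = space \<pi>" using sets by (rule sets_eq_imp_space_eq)
  have [measurable]: "G \<in> borel_measurable \<rho>" by measurable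
  have Gp: "(\<integral>\<^sup>+\<theta>. e2ennreal (G \<theta>) \<partial>\<rho>) < \<infinity>"
    using G_fin by (rule eintegral_finiteD)
  have "AE \<theta> in \<rho>. e2ennreal (G \<theta>) \<noteq> \<infinity>"
    using Gp by (intro nn_integral_PInf_AE) auto
  then have Gr: "AE \<theta> in \<rho>. G \<theta> = ereal (real_of_ereal (G \<theta>))"
    using AE_space
  proof eventually_elim
    case (elim \<theta>)
    then show ?case using G_mi[of \<theta>] by (cases "G \<theta>") (auto simp: sp)
  qed
  \<comment> \<open>If Z vanished, \<open>G\<close> would be \<infinity> almost everywhere under
    \<open>\<pi>\<close>, hence under \<open>\<rho>\<close>, which contradicts the finite positive
    part of \<open>G\<close>.\<close>
  show Z0: "0 < Z"
  proof (rule ccontr)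
    assume "\<not> 0 < Z"
    then have "AE \<theta> in \<pi>. exp_neg \<alpha> (G \<theta>) = 0"
      unfolding Z by (subst (asm) zero_less_iff_neq_zero) (simp add: nn_integral_0_iff_AE)
    then have "AE \<theta> in \<pi>. G \<theta> = \<infinity>"
      by eventually_elim (auto simp: exp_neg_def split: if_splits)
    then have "AE \<theta> in \<rho>. G \<theta> = \<infinity>"
      using AE_KL_finite[OF assms(1-3) KL_fin] by blast
    with Gr have "AE \<theta> in \<rho>. False" by eventually_elim (metis ereal.distinct(1) infinity_ereal_def)
    then show False by simp
  qed
  define z where "z = enn2real Z"
  have z: "0 < z" "Z = ennreal z"
    using Z0 Z_fin by (auto simp: z_def enn2real_positive_iff less_top)
  define g where "g \<theta> = (if G \<theta> = \<infinity> then 0 else exp (- (\<alpha> * real_of_ereal (G \<theta>))) / z)" for \<theta>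
  have g_eq: "exp_neg \<alpha> (G \<theta>) / Z = ennreal (g \<theta>)" for \<theta>
    using z by (simp add: exp_neg_def g_def divide_ennreal)
  have [measurable]: "g \<in> borel_measurable \<pi>"
    unfolding g_def by measurable
  let ?D = "density \<pi> (\<lambda>\<theta>. exp_neg \<alpha> (G \<theta>) / Z)"
  show prob: "prob_space ?D"
  proof (rule prob_spaceI)
    have "emeasure ?D (space ?D) = (\<integral>\<^sup>+\<theta>. exp_neg \<alpha> (G \<theta>) / Z \<partial>\<pi>)"
      by (simp add: emeasure_density cong: nn_integral_cong)
    also have "\<dots> = Z / Z" unfolding Z by (rule nn_integral_divide) simp
    also have "\<dots> = 1" using Z0 Z_fin by (simp add: ennreal_divide_self less_top)
    finally show "emeasure ?D (space ?D) = 1" .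
  qed
  have ln_g: "AE \<theta> in \<rho>. 0 < g \<theta> \<and> ln (g \<theta>) = - (\<alpha> * real_of_ereal (G \<theta>)) - ln z"
    using Gr
  proof eventually_elim
    case (elim \<theta>)
    then have "G \<theta> \<noteq> \<infinity>" by auto
    then show ?case using z by (simp add: g_def ln_div)
  qed
  \<comment> \<open>\<open>KL_change_base\<close> asks only for the negative part of ln g, and that
    is at most \<alpha> times the positive part of \<open>G\<close> plus the positive part of ln
    z.\<close>
  have "(\<integral>\<^sup>+\<theta>. ennreal (- ln (g \<theta>)) \<partial>\<rho>) \<le> (\<integral>\<^sup>+\<theta>. ennreal \<alpha> * e2ennreal (G \<theta>) + ennreal (ln z) \<partial>\<rho>)"
  proof (rule nn_integral_mono_AE)
    show "AE \<theta> in \<rho>. ennreal (- ln (g \<theta>)) \<le> ennreal \<alpha> * e2ennreal (G \<theta>) + ennreal (ln z)"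
      using ln_g Gr
    proof eventually_elim
      case (elim \<theta>)
      obtain r where r: "G \<theta> = ereal r" using elim by metis
      have "ennreal (- ln (g \<theta>)) = ennreal (\<alpha> * r + ln z)" using elim r by (intro arg_cong[where f = ennreal]) simp
      also have "\<dots> \<le> ennreal (max 0 (\<alpha> * r) + max 0 (ln z))"
        by (intro ennreal_leI) linarith
      also have "\<dots> = ennreal (max 0 (\<alpha> * r)) + ennreal (max 0 (ln z))"
        by (intro ennreal_plus) auto
      also have "\<dots> = ennreal \<alpha> * e2ennreal (G \<theta>) + ennreal (ln z)"
        using \<alpha> by (simp add: r e2ennreal_ereal ennreal_mult'[symmetric] max_def ennreal_neg)
      finally show ?case .
    qed
  qed
  also have "\<dots> = ennreal \<alpha> * (\<integral>\<^sup>+\<theta>. e2ennreal (G \<theta>) \<partial>\<rho>) + ennreal (ln z)"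
    by (simp add: nn_integral_add nn_integral_cmult \<rho>.emeasure_space_1)
  also have "\<dots> < \<infinity>" using Gp by (simp add: ennreal_mult_less_top)
  finally have gfin: "(\<integral>\<^sup>+\<theta>. ennreal (- ln (g \<theta>)) \<partial>\<rho>) < \<infinity>" .
  have prob': "prob_space (density \<pi> (\<lambda>\<theta>. ennreal (g \<theta>)))"
    using prob by (simp add: g_eq)
  have gpos: "AE \<theta> in \<rho>. 0 < g \<theta>" using ln_g by eventually_elim simp
  have ig: "integrable \<rho> (\<lambda>\<theta>. ln (g \<theta>))"
    and KL_g: "KL \<rho> (density \<pi> (\<lambda>\<theta>. ennreal (g \<theta>))) = KL \<rho> \<pi> - ereal (\<integral>\<theta>. ln (g \<theta>) \<partial>\<rho>)"
    using KL_change_base[OF assms(1-3) KL_fin _ prob' gpos gfin] by simp_all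
  \<comment> \<open>Solving the affine relation for \<open>G\<close> carries the integrability of ln
    g over to \<open>G\<close>, including its so far uncontrolled negative part.\<close>
  have G_eq: "AE \<theta> in \<rho>. (- ln (g \<theta>) - ln z) / \<alpha> = real_of_ereal (G \<theta>)"
    using ln_g by eventually_elim (use \<alpha> in simp)
  have "integrable \<rho> (\<lambda>\<theta>. (- ln (g \<theta>) - ln z) / \<alpha>)" using ig by simp
  also have "?this \<longleftrightarrow> integrable \<rho> (\<lambda>\<theta>. real_of_ereal (G \<theta>))"
    by (rule integrable_cong_AE) (use G_eq in simp_all)
  finally have iG: "integrable \<rho> (\<lambda>\<theta>. real_of_ereal (G \<theta>))" .
  note eG = eintegral_eq_integral[OF iG Gr]
  show "(\<integral>\<^sup>+\<theta>. e2ennreal (- G \<theta>) \<partial>\<rho>) < \<infinity>" by (rule eG(3))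
  have "(\<integral>\<theta>. ln (g \<theta>) \<partial>\<rho>) = (\<integral>\<theta>. - (\<alpha> * real_of_ereal (G \<theta>)) - ln z \<partial>\<rho>)"
  proof (rule integral_cong_AE)
    show "AE \<theta> in \<rho>. ln (g \<theta>) = - (\<alpha> * real_of_ereal (G \<theta>)) - ln z"
      using ln_g by eventually_elim simp
  qed simp_all
  also have "\<dots> = - (\<alpha> * (\<integral>\<theta>. real_of_ereal (G \<theta>) \<partial>\<rho>)) - ln z"
    using iG by (simp add: \<rho>.prob_space)
  finally have I: "(\<integral>\<theta>. ln (g \<theta>) \<partial>\<rho>) = - (\<alpha> * (\<integral>\<theta>. real_of_ereal (G \<theta>) \<partial>\<rho>)) - ln z" .
  have "KL \<rho> \<pi> - ereal (\<integral>\<theta>. ln (g \<theta>) \<partial>\<rho>) = ereal \<alpha> * eintegral \<rho> G + KL \<rho> \<pi> + ereal (ln z)"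
    unfolding I eG(1) by (cases "KL \<rho> \<pi>") auto
  then show "KL \<rho> ?D = ereal \<alpha> * eintegral \<rho> G + KL \<rho> \<pi> + ereal (ln (enn2real Z))"
    using KL_g by (simp add: g_eq z_def)
qed

text \<open>The inequality at one fixed sample: \<open>G\<close> stands for the log-likelihood ratio
  as a function of the parameter, and \<open>B\<close> for its Laplace transform at \<alpha>. The
  summand \<open>1\<close> on the left comes from ln Y \<le> Y - 1.\<close>

lemma variational_minimiser_bound:
  assumes \<pi>: "prob_space \<pi>"
    and F: "\<And>\<rho>. \<rho> \<in> F \<Longrightarrow> prob_space \<rho>" "\<And>\<rho>. \<rho> \<in> F \<Longrightarrow> sets \<rho> = sets \<pi>"
    and G[measurable]: "G \<in> borel_measurable \<pi>" and G_mi: "\<And>\<theta>. \<theta> \<in> space \<pi> \<Longrightarrow> G \<theta> \<noteq> -\<infinity>"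
    and \<alpha>: "0 < \<alpha>" and Z: "Z = (\<integral>\<^sup>+\<theta>. exp_neg \<alpha> (G \<theta>) \<partial>\<pi>)"
    and B[measurable]: "B \<in> borel_measurable \<pi>" and B1: "\<And>\<theta>. \<theta> \<in> space \<pi> \<Longrightarrow> B \<theta> \<le> 1"
    and Y: "Y = (\<integral>\<^sup>+\<theta>. exp_neg \<alpha> (G \<theta>) * inverse (B \<theta>) \<partial>\<pi>)" and Y_fin: "Y < \<infinity>"
    and \<rho>: "\<rho> \<in> F" and KL_fin: "KL \<rho> \<pi> \<noteq> \<infinity>" and G_fin: "eintegral \<rho> G \<noteq> \<infinity>"
    and min: "is_arg_min (\<lambda>\<rho>. KL \<rho> (density \<pi> (\<lambda>\<theta>. exp_neg \<alpha> (G \<theta>) / Z))) (\<lambda>\<rho>. \<rho> \<in> F) \<rho>' \<or>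
      is_arg_min (\<lambda>\<rho>. ereal \<alpha> * eintegral \<rho> G + KL \<rho> \<pi>) (\<lambda>\<rho>. \<rho> \<in> F) \<rho>'"
  shows "(\<integral>\<^sup>+\<theta>. e2ennreal (- eln (B \<theta>)) \<partial>\<rho>') + ennreal \<alpha> * (\<integral>\<^sup>+\<theta>. e2ennreal (- G \<theta>) \<partial>\<rho>) + 1
    \<le> ennreal \<alpha> * (\<integral>\<^sup>+\<theta>. e2ennreal (G \<theta>) \<partial>\<rho>) + e2ennreal (KL \<rho> \<pi>) + Y"
proof -
  have \<rho>': "\<rho>' \<in> F" using min by (auto simp: is_arg_min_def)
  have "Z \<le> Y" unfolding Z Y
  proof (rule nn_integral_mono)
    fix \<theta> assume "\<theta> \<in> space \<pi>"
    then have "1 \<le> inverse (B \<theta>)"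
      using B1[of \<theta>]
      by (cases "B \<theta>"; cases "B \<theta> = 0")
        (auto simp: top_unique inverse_ennreal less_le one_le_inverse simp flip: ennreal_1)
    then show "exp_neg \<alpha> (G \<theta>) \<le> exp_neg \<alpha> (G \<theta>) * inverse (B \<theta>)"
      using mult_left_mono[of 1 "inverse (B \<theta>)" "exp_neg \<alpha> (G \<theta>)"] by simp
  qed
  then have Z_fin: "Z < \<infinity>" using Y_fin by (rule le_less_trans)
  note KL_t = KL_tempered[OF \<pi> F(1) F(2) G G_mi \<alpha> Z Z_fin]
  note t = KL_t[OF \<rho> \<rho> _ KL_fin G_fin]
  let ?D = "density \<pi> (\<lambda>\<theta>. exp_neg \<alpha> (G \<theta>) / Z)"
  have D: "prob_space ?D" and Z0: "0 < Z" and Gm: "(\<integral>\<^sup>+\<theta>. e2ennreal (- G \<theta>) \<partial>\<rho>) < \<infinity>"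
    using t by auto
  note Gp = eintegral_finiteD[OF G_fin]
  define a where "a = enn2real (\<integral>\<^sup>+\<theta>. e2ennreal (G \<theta>) \<partial>\<rho>)"
  define b where "b = enn2real (\<integral>\<^sup>+\<theta>. e2ennreal (- G \<theta>) \<partial>\<rho>)"
  define k where "k = real_of_ereal (KL \<rho> \<pi>)"
  have a: "(\<integral>\<^sup>+\<theta>. e2ennreal (G \<theta>) \<partial>\<rho>) = ennreal a" "0 \<le> a" using Gp by (auto simp: a_def less_top)
  have b: "(\<integral>\<^sup>+\<theta>. e2ennreal (- G \<theta>) \<partial>\<rho>) = ennreal b" "0 \<le> b" using Gm by (auto simp: b_def less_top)
  have eG: "eintegral \<rho> G = ereal (a - b)" using a b by (simp add: eintegral_def)
  have "0 \<le> KL \<rho> \<pi>" by (rule KL_nonneg[OF \<pi> F(1)[OF \<rho>] F(2)[OF \<rho>]])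
  then have k: "KL \<rho> \<pi> = ereal k" "0 \<le> k" using KL_fin by (cases "KL \<rho> \<pi>"; simp add: k_def)+
  have t': "KL \<rho> ?D = ereal (\<alpha> * (a - b) + k + ln (enn2real Z))"
    using t(4) by (simp add: eG k)
  have le: "KL \<rho>' ?D \<le> KL \<rho> ?D"
    using min
  proof
    assume "is_arg_min (\<lambda>\<rho>. KL \<rho> ?D) (\<lambda>\<rho>. \<rho> \<in> F) \<rho>'"
    then show ?thesis using \<rho> by (auto simp: is_arg_min_linorder)
  next
    assume "is_arg_min (\<lambda>\<rho>. ereal \<alpha> * eintegral \<rho> G + KL \<rho> \<pi>) (\<lambda>\<rho>. \<rho> \<in> F) \<rho>'"
    then have le: "ereal \<alpha> * eintegral \<rho>' G + KL \<rho>' \<pi> \<le> ereal \<alpha> * eintegral \<rho> G + KL \<rho> \<pi>"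
      using \<rho> by (auto simp: is_arg_min_linorder)
    then have "ereal \<alpha> * eintegral \<rho>' G + KL \<rho>' \<pi> \<noteq> \<infinity>" by (auto simp: eG k)
    \<comment> \<open>A sum of extended reals with a summand \<infinity> is \<infinity>, even if the
      other one is - \<infinity>. So neither summand at \<open>\<rho>'\<close> is \<infinity>,
      \<open>KL_tempered\<close> applies to \<open>\<rho>'\<close> as well, and the second objective
      is compared through the first.\<close>
    then have fin: "KL \<rho>' \<pi> \<noteq> \<infinity>" "eintegral \<rho>' G \<noteq> \<infinity>"
      using \<alpha> by auto
    show ?thesis
      using KL_t(4)[OF \<rho>' \<rho>' _ fin] t(4) le by (simp add: add_right_mono)
  qed
  then have fin': "KL \<rho>' ?D \<noteq> \<infinity>" by (auto simp: t')
  have sets': "sets \<rho>' = sets ?D" using F(2)[OF \<rho>'] by simp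
  have [measurable_cong]: "sets \<rho>' = sets \<pi>" using F(2)[OF \<rho>'] .
  \<comment> \<open>Where \<open>B\<close> is \<open>0\<close> its inverse is \<infinity>, so a
    finite product forces the weight to be \<open>0\<close>. Such points are null for the tilted
    measure \<open>?D\<close>, and then for \<open>\<rho>'\<close> by absolute continuity.\<close>
  have "AE \<theta> in \<pi>. exp_neg \<alpha> (G \<theta>) * inverse (B \<theta>) \<noteq> \<infinity>"
    using Y_fin unfolding Y by (intro nn_integral_PInf_AE) auto
  then have "AE \<theta> in ?D. B \<theta> \<noteq> 0 \<and> B \<theta> \<le> 1"
    using AE_space B1 by (subst AE_density) (auto elim!: eventually_elim2 simp: ennreal_mult_eq_top_iff)
  note B0 = this AE_KL_finite[OF D F(1)[OF \<rho>'] sets' fin' this]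
  \<comment> \<open>On the relevant set \<open>B \<theta> \<le> 1\<close>, so this is just - ln B.
    The maximum only ensures nonnegativity everywhere, as \<open>Donsker_Varadhan_le\<close>
    demands.\<close>
  define u where "u \<theta> = max 0 (- ln (enn2real (B \<theta>)))" for \<theta>
  have u: "e2ennreal (- eln (B \<theta>)) = ennreal (u \<theta>) \<and> ennreal (exp (u \<theta>)) = inverse (B \<theta>)"
    if B0: "B \<theta> \<noteq> 0 \<and> B \<theta> \<le> 1" for \<theta>
  proof -
    define r where "r = enn2real (B \<theta>)"
    have "B \<theta> < \<top>" using that by (auto intro: le_less_trans)
    then have r: "B \<theta> = ennreal r" "0 < r" "r \<le> 1"
      using that by (auto simp: r_def enn2real_positive_iff zero_less_iff_neq_zero intro: enn2real_leI)
    then have "u \<theta> = - ln r" "exp (- ln r) = inverse r" by (auto simp: u_def exp_minus)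
    then show ?thesis using r by (simp add: eln_def e2ennreal_ereal inverse_ennreal)
  qed
  have "(\<integral>\<^sup>+\<theta>. ennreal (exp (u \<theta>)) \<partial>?D) = (\<integral>\<^sup>+\<theta>. inverse (B \<theta>) \<partial>?D)"
    by (intro nn_integral_cong_AE eventually_mono[OF B0(1)]) (simp add: u)
  also have "\<dots> = (\<integral>\<^sup>+\<theta>. exp_neg \<alpha> (G \<theta>) * inverse (B \<theta>) / Z \<partial>\<pi>)"
    by (subst nn_integral_density) (auto simp: ennreal_times_divide mult.commute intro!: nn_integral_cong)
  also have "\<dots> = Y / Z" unfolding Y by (rule nn_integral_divide) simp
  finally have exp_u: "(\<integral>\<^sup>+\<theta>. ennreal (exp (u \<theta>)) \<partial>?D) = Y / Z" .
  define z y where "z = enn2real Z" and "y = enn2real Y"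
  have z: "0 < z" "Z = ennreal z"
    using Z0 Z_fin by (auto simp: z_def enn2real_positive_iff less_top)
  have y: "0 < y" "Y = ennreal y"
    using Z0 \<open>Z \<le> Y\<close> Y_fin by (auto simp: y_def enn2real_positive_iff less_top)
  have c: "0 < y / z" "(\<integral>\<^sup>+\<theta>. ennreal (exp (u \<theta>)) \<partial>?D) \<le> ennreal (y / z)"
    using y z unfolding exp_u by (simp_all add: divide_ennreal)
  have u_m: "u \<in> borel_measurable ?D" unfolding u_def by measurable
  have u0: "0 \<le> u \<theta>" for \<theta> by (simp add: u_def)
  note DV = Donsker_Varadhan_le[OF D F(1)[OF \<rho>'] sets' fin' u_m u0 c]
  have "ereal (\<integral>\<theta>. u \<theta> \<partial>\<rho>') \<le> KL \<rho> ?D + ereal (ln (y / z))"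
    using DV(2) le by (meson add_right_mono order_trans)
  also have "\<dots> = ereal (\<alpha> * (a - b) + k + ln y)"
    using y(1) z(1) unfolding t' z_def[symmetric] by (simp add: ln_div)
  finally have "(\<integral>\<theta>. u \<theta> \<partial>\<rho>') \<le> \<alpha> * (a - b) + k + ln y" by simp
  also have "ln y \<le> y - 1" using y by (rule_tac ln_le_minus_one) simp
  finally have main: "(\<integral>\<theta>. u \<theta> \<partial>\<rho>') + \<alpha> * b + 1 \<le> \<alpha> * a + k + y" by (simp add: algebra_simps)
  have iu0: "0 \<le> (\<integral>\<theta>. u \<theta> \<partial>\<rho>')" using u0 by simp
  have "(\<integral>\<^sup>+\<theta>. e2ennreal (- eln (B \<theta>)) \<partial>\<rho>') = (\<integral>\<^sup>+\<theta>. ennreal (u \<theta>) \<partial>\<rho>')"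
    by (intro nn_integral_cong_AE eventually_mono[OF B0(2)]) (simp add: u)
  also have "\<dots> = ennreal (\<integral>\<theta>. u \<theta> \<partial>\<rho>')"
    using DV(1) u0 by (intro nn_integral_eq_integral) auto
  finally have "(\<integral>\<^sup>+\<theta>. e2ennreal (- eln (B \<theta>)) \<partial>\<rho>') + ennreal \<alpha> * ennreal b + 1
      = ennreal ((\<integral>\<theta>. u \<theta> \<partial>\<rho>') + \<alpha> * b + 1)"
    using \<alpha> b iu0 by (simp add: ennreal_mult)
  also have "\<dots> \<le> ennreal (\<alpha> * a + k + y)" using main by (rule ennreal_leI)
  also have "\<dots> = ennreal \<alpha> * ennreal a + e2ennreal (KL \<rho> \<pi>) + Y"
    using \<alpha> a k y by (simp add: e2ennreal_ereal ennreal_mult)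
  finally show ?thesis by (simp add: a b)
qed

lemma eln_power:
  assumes "0 < n"
  shows "eln (a ^ n) = ereal (real n) * eln a"
proof (cases a rule: ennreal_cases)
  case (real r)
  then show ?thesis
    using assms by (cases "r = 0") (auto simp: eln_def ennreal_power ln_realpow power_0_left)
qed (use assms in \<open>simp add: eln_def power_eq_top_ennreal\<close>)

section \<open>The dominated model: affinity and Renyi divergence\<close>

locale dominated_model =
  fixes Q :: "'a measure"
    and T :: "'t measure"
    and P :: "'t \<Rightarrow> 'a measure"
    and p :: "'t \<Rightarrow> 'a \<Rightarrow> real"
    and \<theta>\<^sub>0 :: 't
    and n :: nat
    and \<alpha> :: real
  assumes prob_P: "\<And>\<theta>. \<theta> \<in> space T \<Longrightarrow> prob_space (P \<theta>)"
    and p_measurable: "\<And>\<theta>. \<theta> \<in> space T \<Longrightarrow> p \<theta> \<in> borel_measurable Q"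
    and p_nonneg: "\<And>\<theta> x. \<theta> \<in> space T \<Longrightarrow> x \<in> space Q \<Longrightarrow> 0 \<le> p \<theta> x"
    and P_eq: "\<And>\<theta>. \<theta> \<in> space T \<Longrightarrow> P \<theta> = density Q (\<lambda>x. ennreal (p \<theta> x))"
    and \<theta>\<^sub>0: "\<theta>\<^sub>0 \<in> space T"
    and n: "1 \<le> n"
    and \<alpha>: "0 < \<alpha>" "\<alpha> < 1"
    and llr_measurable: "(\<lambda>(x, \<theta>). log_lik_ratio n p \<theta> \<theta>\<^sub>0 x)
           \<in> borel_measurable (Pi\<^sub>M {1..n} (\<lambda>_. P \<theta>\<^sub>0) \<Otimes>\<^sub>M T)"
begin

declare One_nat_def [simp del] \<comment> \<open>otherwise the simplifier rewrites the index set of \<open>sample\<close>\<close>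

abbreviation sample :: "(nat \<Rightarrow> 'a) measure" where
  "sample \<equiv> Pi\<^sub>M {1..n} (\<lambda>_. P \<theta>\<^sub>0)"

abbreviation llr :: "'t \<Rightarrow> (nat \<Rightarrow> 'a) \<Rightarrow> ereal" where
  "llr \<theta> x \<equiv> log_lik_ratio n p \<theta> \<theta>\<^sub>0 x"

text \<open>The Hellinger-type affinity, or Chernoff coefficient, of order \<alpha>. It is written
  as an expectation of a likelihood ratio power so that it factorises over the sample.\<close>

definition affinity :: "'t \<Rightarrow> ennreal" where
  "affinity \<theta> = (\<integral>\<^sup>+x. ennreal ((p \<theta> x / p \<theta>\<^sub>0 x) powr \<alpha>) \<partial>P \<theta>\<^sub>0)"

text \<open>The n-th power of the affinity, and the B of the pathwise inequality. Defining it
  through \<open>llr\<close> gives measurability in the parameter: joint measurability is assumed of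
  the log-likelihood ratio, whereas \<open>p\<close> is assumed measurable only in the
  observation.\<close>

definition laplace :: "'t \<Rightarrow> ennreal" where
  "laplace \<theta> = (\<integral>\<^sup>+x. exp_neg \<alpha> (llr \<theta> x) \<partial>sample)"

sublocale P0: prob_space "P \<theta>\<^sub>0" using prob_P \<theta>\<^sub>0 .

sublocale P0: product_sigma_finite "\<lambda>_::nat. P \<theta>\<^sub>0" ..

sublocale sample: prob_space sample
  by (intro prob_space_PiM prob_P \<theta>\<^sub>0)

lemma sets_P: "\<theta> \<in> space T \<Longrightarrow> sets (P \<theta>) = sets Q"
  using P_eq by simp

lemma space_P: "\<theta> \<in> space T \<Longrightarrow> space (P \<theta>) = space Q"
  using sets_P by (rule sets_eq_imp_space_eq)

lemma nn_integral_p: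
  assumes "\<theta> \<in> space T"
  shows "(\<integral>\<^sup>+x. ennreal (p \<theta> x) \<partial>Q) = 1"
proof -
  have "emeasure (P \<theta>) (space (P \<theta>)) = 1"
    using prob_P[OF assms] by (rule prob_space.emeasure_space_1)
  then show ?thesis
    unfolding P_eq[OF assms] using p_measurable[OF assms]
    by (simp add: emeasure_density cong: nn_integral_cong)
qed

lemma affinity_eq:
  assumes \<theta>: "\<theta> \<in> space T"
  shows "affinity \<theta> = (\<integral>\<^sup>+x. ennreal (p \<theta> x powr \<alpha> * p \<theta>\<^sub>0 x powr (1 - \<alpha>)) \<partial>Q)"
proof -
  note [measurable] = p_measurable[OF \<theta>] p_measurable[OF \<theta>\<^sub>0]
  have "affinity \<theta> = (\<integral>\<^sup>+x. ennreal (p \<theta>\<^sub>0 x) * ennreal ((p \<theta> x / p \<theta>\<^sub>0 x) powr \<alpha>) \<partial>Q)"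
    unfolding affinity_def P_eq[OF \<theta>\<^sub>0] by (rule nn_integral_density) auto
  also have "\<dots> = (\<integral>\<^sup>+x. ennreal (p \<theta> x powr \<alpha> * p \<theta>\<^sub>0 x powr (1 - \<alpha>)) \<partial>Q)"
  proof (rule nn_integral_cong)
    fix x assume x: "x \<in> space Q"
    \<comment> \<open>Where the density at \<open>\<theta>\<^sub>0\<close> is \<open>0\<close> both
      sides vanish, the right one because \<open>0 powr (1 - \<alpha>) = 0\<close>.\<close>
    show "ennreal (p \<theta>\<^sub>0 x) * ennreal ((p \<theta> x / p \<theta>\<^sub>0 x) powr \<alpha>) =
      ennreal (p \<theta> x powr \<alpha> * p \<theta>\<^sub>0 x powr (1 - \<alpha>))"
      using p_nonneg[OF \<theta> x] p_nonneg[OF \<theta>\<^sub>0 x] \<alpha>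
      by (cases "p \<theta>\<^sub>0 x = 0")
        (simp_all add: powr_divide powr_diff mult.commute flip: ennreal_mult')
  qed
  finally show ?thesis .
qed

text \<open>Young's inequality with weights \<alpha> and 1 - \<alpha>, applied pointwise to two
  densities that each integrate to one.\<close>

lemma affinity_le_1:
  assumes \<theta>: "\<theta> \<in> space T"
  shows "affinity \<theta> \<le> 1"
proof -
  note [measurable] = p_measurable[OF \<theta>] p_measurable[OF \<theta>\<^sub>0]
  have "affinity \<theta> \<le> (\<integral>\<^sup>+x. ennreal \<alpha> * ennreal (p \<theta> x) + ennreal (1 - \<alpha>) * ennreal (p \<theta>\<^sub>0 x) \<partial>Q)"
    unfolding affinity_eq[OF \<theta>]
  proof (rule nn_integral_mono)
    fix x assume x: "x \<in> space Q"
    have nn: "0 \<le> p \<theta> x" "0 \<le> p \<theta>\<^sub>0 x" using p_nonneg \<theta> \<theta>\<^sub>0 x by auto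
    have "p \<theta> x powr \<alpha> * p \<theta>\<^sub>0 x powr (1 - \<alpha>) \<le> \<alpha> * p \<theta> x + (1 - \<alpha>) * p \<theta>\<^sub>0 x"
    proof (cases "p \<theta> x = 0 \<or> p \<theta>\<^sub>0 x = 0")
      case True
      then show ?thesis using nn \<alpha> by auto
    next
      case False
      then show ?thesis using nn \<alpha> by (intro Youngs_inequality_0) auto
    qed
    then show "ennreal (p \<theta> x powr \<alpha> * p \<theta>\<^sub>0 x powr (1 - \<alpha>)) \<le>
        ennreal \<alpha> * ennreal (p \<theta> x) + ennreal (1 - \<alpha>) * ennreal (p \<theta>\<^sub>0 x)"
      using nn \<alpha> by (simp add: ennreal_leI flip: ennreal_mult ennreal_plus)
  qed
  also have "\<dots> = ennreal \<alpha> + ennreal (1 - \<alpha>)"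
    by (simp add: nn_integral_add nn_integral_cmult nn_integral_p \<theta> \<theta>\<^sub>0)
  also have "\<dots> = 1" using \<alpha> by (simp flip: ennreal_plus)
  finally show ?thesis .
qed

lemma renyi_divergence_eq:
  assumes \<theta>: "\<theta> \<in> space T"
  shows "renyi_divergence \<alpha> Q (P \<theta>) (P \<theta>\<^sub>0) = ereal (1 / (1 - \<alpha>)) * (- eln (affinity \<theta>))"
proof -
  \<comment> \<open>\<open>Q\<close> is an arbitrary measure here, so uniqueness of the derivative
    is drawn from sigma-finiteness of the probability measure \<open>P \<eta>\<close>.\<close>
  have RN: "AE x in Q. RN_deriv Q (P \<eta>) x = ennreal (p \<eta> x)" if "\<eta> \<in> space T" for \<eta>
  proof -
    interpret prob_space "P \<eta>" using prob_P that .
    have "AE x in Q. ennreal (p \<eta> x) = RN_deriv Q (P \<eta>) x"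
      using p_measurable[OF that] P_eq[OF that]
      by (intro RN_deriv_unique_sigma_finite sigma_finite_measure_axioms) auto
    then show ?thesis by (auto simp: eq_commute)
  qed
  have "(\<integral>\<^sup>+x. ennreal (enn2real (RN_deriv Q (P \<theta>) x) powr \<alpha> *
            enn2real (RN_deriv Q (P \<theta>\<^sub>0) x) powr (1 - \<alpha>)) \<partial>Q) = affinity \<theta>"
    unfolding affinity_eq[OF \<theta>]
  proof (rule nn_integral_cong_AE)
    show "AE x in Q. ennreal (enn2real (RN_deriv Q (P \<theta>) x) powr \<alpha> *
        enn2real (RN_deriv Q (P \<theta>\<^sub>0) x) powr (1 - \<alpha>)) =
        ennreal (p \<theta> x powr \<alpha> * p \<theta>\<^sub>0 x powr (1 - \<alpha>))"
      using RN[OF \<theta>] RN[OF \<theta>\<^sub>0] AE_space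
      by eventually_elim (simp add: p_nonneg \<theta> \<theta>\<^sub>0)
  qed
  moreover have "1 / (\<alpha> - 1) = - (1 / (1 - \<alpha>))" using \<alpha> by (simp add: field_simps)
  ultimately show ?thesis
    unfolding renyi_divergence_def by (metis ereal_mult_minus_left ereal_mult_minus_right uminus_ereal.simps(1))
qed

section \<open>The log-likelihood ratio and the tempered posterior at a typical sample\<close>

text \<open>Removes the null set of samples on which a summand of \<open>llr\<close> can be -
  \<infinity>. On what remains, \<open>exp_neg\<close> never meets its junk value and the likelihood
  at \<open>\<theta>\<^sub>0\<close> can be cancelled.\<close>

lemma AE_p\<^sub>0_pos: "AE x in sample. x \<in> space sample \<and> (\<forall>i\<in>{1..n}. 0 < p \<theta>\<^sub>0 (x i))"
proof -
  have "AE y in P \<theta>\<^sub>0. 0 < p \<theta>\<^sub>0 y"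
    unfolding P_eq[OF \<theta>\<^sub>0] using p_measurable[OF \<theta>\<^sub>0] by (subst AE_density) auto
  then have "AE x in sample. \<forall>i\<in>{1..n}. 0 < p \<theta>\<^sub>0 (x i)"
    by (intro AE_finite_allI AE_PiM_component prob_P \<theta>\<^sub>0) auto
  with AE_space show ?thesis by eventually_elim simp
qed

lemma sample_space: "x \<in> space sample \<Longrightarrow> i \<in> {1..n} \<Longrightarrow> x i \<in> space Q"
  by (auto simp: space_PiM space_P \<theta>\<^sub>0)

context
  fixes x \<theta>
  assumes x: "x \<in> space sample" "\<forall>i\<in>{1..n}. 0 < p \<theta>\<^sub>0 (x i)" and \<theta>: "\<theta> \<in> space T"
begin

text \<open>In \<open>ennreal\<close> a positive number divided by \<open>0\<close> is \<infinity>,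
  and a positive numerator rules out the value - \<infinity>.\<close>

lemma llr_summand:
  assumes "i \<in> {1..n}"
  shows "eln (ennreal (p \<theta>\<^sub>0 (x i)) / ennreal (p \<theta> (x i))) =
    (if p \<theta> (x i) = 0 then \<infinity> else ereal (ln (p \<theta>\<^sub>0 (x i) / p \<theta> (x i))))"
proof -
  have "0 \<le> p \<theta> (x i)" "0 < p \<theta>\<^sub>0 (x i)"
    using p_nonneg[OF \<theta>] sample_space[OF x(1) assms] x(2) assms by auto
  then show ?thesis
    by (auto simp: eln_def divide_ennreal ennreal_divide_zero)
qed

lemma llr_neq_MInf: "llr \<theta> x \<noteq> -\<infinity>"
proof -
  have "sum f A \<noteq> -\<infinity>" if "\<And>i. i \<in> A \<Longrightarrow> f i \<noteq> -\<infinity>" for A :: "nat set" and f :: "nat \<Rightarrow> ereal"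
    using that by (induction A rule: infinite_finite_induct) auto
  then show ?thesis unfolding log_lik_ratio_def by (simp add: llr_summand)
qed

text \<open>The product form needed for independence. If some factor vanishes, then
  \<open>llr\<close> is \<infinity> and \<open>exp_neg\<close> gives \<open>0\<close>, in agreement
  with the product.\<close>

lemma exp_neg_llr:
  "exp_neg \<alpha> (llr \<theta> x) = (\<Prod>i\<in>{1..n}. ennreal ((p \<theta> (x i) / p \<theta>\<^sub>0 (x i)) powr \<alpha>))"
proof (cases "\<exists>i\<in>{1..n}. p \<theta> (x i) = 0")
  case True
  then have "llr \<theta> x = \<infinity>"
    unfolding log_lik_ratio_def by (subst sum_Pinfty) (auto simp: llr_summand)
  moreover have "(\<Prod>i\<in>{1..n}. ennreal ((p \<theta> (x i) / p \<theta>\<^sub>0 (x i)) powr \<alpha>)) = 0"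
    using True by (intro prod_zero) auto
  ultimately show ?thesis by (simp add: exp_neg_def)
next
  case False
  have pos: "0 < p \<theta> (x i)" "0 < p \<theta>\<^sub>0 (x i)" if "i \<in> {1..n}" for i
    using False p_nonneg[OF \<theta>] sample_space[OF x(1) that] x(2) that by (auto simp: less_le)
  have "llr \<theta> x = (\<Sum>i = 1..n. ereal (ln (p \<theta>\<^sub>0 (x i) / p \<theta> (x i))))"
    unfolding log_lik_ratio_def using False by (intro sum.cong) (auto simp: llr_summand)
  then have "llr \<theta> x = ereal (\<Sum>i = 1..n. ln (p \<theta>\<^sub>0 (x i) / p \<theta> (x i)))" by simp
  then have "exp_neg \<alpha> (llr \<theta> x) = ennreal (exp (\<Sum>i = 1..n. - (\<alpha> * ln (p \<theta>\<^sub>0 (x i) / p \<theta> (x i)))))"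
    by (simp add: exp_neg_def sum_distrib_left sum_negf)
  also have "\<dots> = ennreal (\<Prod>i\<in>{1..n}. exp (- (\<alpha> * ln (p \<theta>\<^sub>0 (x i) / p \<theta> (x i)))))"
    by (simp add: exp_sum)
  also have "\<dots> = ennreal (\<Prod>i\<in>{1..n}. (p \<theta> (x i) / p \<theta>\<^sub>0 (x i)) powr \<alpha>)"
  proof (intro arg_cong[where f = ennreal] prod.cong refl)
    fix i assume i: "i \<in> {1..n}"
    have "- (\<alpha> * ln (p \<theta>\<^sub>0 (x i) / p \<theta> (x i))) = \<alpha> * ln (p \<theta> (x i) / p \<theta>\<^sub>0 (x i))"
      using pos[OF i] by (simp add: ln_div algebra_simps)
    then show "exp (- (\<alpha> * ln (p \<theta>\<^sub>0 (x i) / p \<theta> (x i)))) = (p \<theta> (x i) / p \<theta>\<^sub>0 (x i)) powr \<alpha>"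
      using pos[OF i] by (simp add: powr_def)
  qed
  also have "\<dots> = (\<Prod>i\<in>{1..n}. ennreal ((p \<theta> (x i) / p \<theta>\<^sub>0 (x i)) powr \<alpha>))"
    by (simp add: prod_ennreal)
  finally show ?thesis .
qed

text \<open>The tempered likelihood and the weight differ by a factor that does not involve
  \<theta>; normalisation will remove it.\<close>

lemma powr_likelihood:
  "ennreal ((\<Prod>i = 1..n. p \<theta> (x i)) powr \<alpha>) =
    ennreal ((\<Prod>i = 1..n. p \<theta>\<^sub>0 (x i)) powr \<alpha>) * exp_neg \<alpha> (llr \<theta> x)"
proof -
  have nn: "0 \<le> p \<theta> (x i)" "0 < p \<theta>\<^sub>0 (x i)" if "i \<in> {1..n}" for i
    using p_nonneg[OF \<theta>] sample_space[OF x(1) that] x(2) that by auto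
  have "ennreal ((\<Prod>i = 1..n. p \<theta>\<^sub>0 (x i)) powr \<alpha>) * exp_neg \<alpha> (llr \<theta> x) =
      (\<Prod>i = 1..n. ennreal (p \<theta>\<^sub>0 (x i) powr \<alpha>) * ennreal ((p \<theta> (x i) / p \<theta>\<^sub>0 (x i)) powr \<alpha>))"
    unfolding exp_neg_llr by (simp add: prod.distrib prod_powr_distrib prod_ennreal)
  also have "\<dots> = (\<Prod>i = 1..n. ennreal (p \<theta> (x i) powr \<alpha>))"
  proof (rule prod.cong)
    fix i assume "i \<in> {1..n}"
    then show "ennreal (p \<theta>\<^sub>0 (x i) powr \<alpha>) * ennreal ((p \<theta> (x i) / p \<theta>\<^sub>0 (x i)) powr \<alpha>) = ennreal (p \<theta> (x i) powr \<alpha>)"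
      using nn[of i] by (simp add: powr_divide flip: ennreal_mult')
  qed simp
  also have "\<dots> = ennreal ((\<Prod>i = 1..n. p \<theta> (x i)) powr \<alpha>)"
    by (simp add: prod_powr_distrib prod_ennreal)
  finally show ?thesis ..
qed

end

lemma llr_measurable_param:
  assumes "x \<in> space sample"
  shows "(\<lambda>\<theta>. llr \<theta> x) \<in> borel_measurable T"
  using measurable_compose[OF measurable_Pair1'[OF assms] llr_measurable] by simp

lemma llr_measurable_sample:
  assumes "\<theta> \<in> space T"
  shows "llr \<theta> \<in> borel_measurable sample"
  using measurable_compose[OF measurable_Pair2'[OF assms] llr_measurable] by simp

lemma tempered_posterior_eq:
  assumes x: "x \<in> space sample" "\<forall>i\<in>{1..n}. 0 < p \<theta>\<^sub>0 (x i)" and sets: "sets \<pi> = sets T"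
  shows "tempered_posterior n \<alpha> p \<pi> x =
    density \<pi> (\<lambda>\<theta>. exp_neg \<alpha> (llr \<theta> x) / (\<integral>\<^sup>+\<theta>. exp_neg \<alpha> (llr \<theta> x) \<partial>\<pi>))"
proof -
  have sp: "space \<pi> = space T" using sets by (rule sets_eq_imp_space_eq)
  have [measurable_cong]: "sets \<pi> = sets T" by fact
  note [measurable] = llr_measurable_param[OF x(1)]
  define c where "c = (\<Prod>i = 1..n. p \<theta>\<^sub>0 (x i)) powr \<alpha>"
  have "0 < (\<Prod>i = 1..n. p \<theta>\<^sub>0 (x i))" using x(2) by (intro prod_pos) simp
  then have c: "0 < c" by (metis c_def less_irrefl powr_gt_zero)
  let ?L = "\<lambda>\<theta>. ennreal ((\<Prod>i = 1..n. p \<theta> (x i)) powr \<alpha>)"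
  let ?E = "\<lambda>\<theta>. exp_neg \<alpha> (llr \<theta> x)"
  have L: "?L \<theta> = ennreal c * ?E \<theta>" if "\<theta> \<in> space \<pi>" for \<theta>
    using powr_likelihood[OF x, of \<theta>] that by (simp add: sp c_def)
  \<comment> \<open>Measurability of the likelihood in the parameter is inherited from the
    log-likelihood ratio through \<open>L\<close>.\<close>
  have [measurable]: "?L \<in> borel_measurable \<pi>"
    by (subst measurable_cong[OF L]) auto
  have "(\<integral>\<^sup>+\<theta>. ?L \<theta> \<partial>\<pi>) = (\<integral>\<^sup>+\<theta>. ennreal c * ?E \<theta> \<partial>\<pi>)"
    by (rule nn_integral_cong) (rule L)
  also have "\<dots> = ennreal c * (\<integral>\<^sup>+\<theta>. ?E \<theta> \<partial>\<pi>)"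
    by (rule nn_integral_cmult) measurable
  finally have I: "(\<integral>\<^sup>+\<theta>. ?L \<theta> \<partial>\<pi>) = ennreal c * (\<integral>\<^sup>+\<theta>. ?E \<theta> \<partial>\<pi>)" .
  \<comment> \<open>As \<open>c\<close> is positive and finite, it cancels for all \<open>a\<close>
    and \<open>b\<close>, including a normalising constant that is \<open>0\<close> or
    \<infinity>.\<close>
  have cancel: "(ennreal c * a) / (ennreal c * b) = a / b" for a b
  proof -
    have "ennreal c * inverse (ennreal c) = 1"
      using c by (simp add: inverse_ennreal flip: ennreal_mult)
    moreover have "inverse (ennreal c * b) = inverse (ennreal c) * inverse b"
      using c by (intro ennreal_inverse_mult') auto
    ultimately show ?thesis
      unfolding divide_ennreal_def by (metis mult.assoc mult.commute mult_1)
  qed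
  have eq: "?L \<theta> / (ennreal c * (\<integral>\<^sup>+\<theta>. ?E \<theta> \<partial>\<pi>)) = ?E \<theta> / (\<integral>\<^sup>+\<theta>. ?E \<theta> \<partial>\<pi>)"
    if "\<theta> \<in> space \<pi>" for \<theta>
    by (simp only: L[OF that] cancel)
  have m: "(\<lambda>\<theta>. ?E \<theta> / (\<integral>\<^sup>+\<theta>. ?E \<theta> \<partial>\<pi>)) \<in> borel_measurable \<pi>"
    by measurable
  show ?thesis
    unfolding tempered_posterior_def I
    using m eq by (intro density_cong AE_I2) (simp_all only: measurable_cong[OF eq])
qed

section \<open>The Laplace transform of the log-likelihood ratio and the Renyi divergence\<close>

text \<open>Independence: the integral of a product over the product measure is the product of n
  equal integrals.\<close>

lemma laplace_eq:
  assumes \<theta>: "\<theta> \<in> space T"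
  shows "laplace \<theta> = affinity \<theta> ^ n"
proof -
  have [measurable_cong]: "sets (P \<theta>\<^sub>0) = sets Q" using sets_P \<theta>\<^sub>0 .
  note [measurable] = p_measurable[OF \<theta>] p_measurable[OF \<theta>\<^sub>0]
  have "laplace \<theta> = (\<integral>\<^sup>+x. (\<Prod>i\<in>{1..n}. ennreal ((p \<theta> (x i) / p \<theta>\<^sub>0 (x i)) powr \<alpha>)) \<partial>sample)"
    unfolding laplace_def
    by (intro nn_integral_cong_AE eventually_mono[OF AE_p\<^sub>0_pos]) (blast intro: exp_neg_llr[OF _ _ \<theta>])
  also have "\<dots> = (\<Prod>i\<in>{1..n}. affinity \<theta>)"
    unfolding affinity_def by (rule P0.product_nn_integral_prod) auto
  finally show ?thesis by simp
qed

lemma laplace_le_1: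
  assumes "\<theta> \<in> space T"
  shows "laplace \<theta> \<le> 1"
  using affinity_le_1[OF assms] by (simp add: laplace_eq assms power_le_one)

lemma laplace_measurable: "laplace \<in> borel_measurable T"
proof -
  have [measurable]: "(\<lambda>(\<theta>, x). llr \<theta> x) \<in> borel_measurable (T \<Otimes>\<^sub>M sample)"
    using measurable_pair_swap[OF llr_measurable] by (simp add: case_prod_beta')
  show ?thesis
    unfolding laplace_def by (intro sample.borel_measurable_nn_integral) measurable
qed

lemma renyi_divergence_laplace:
  assumes \<theta>: "\<theta> \<in> space T"
  shows "- eln (laplace \<theta>) = ereal (real n * (1 - \<alpha>)) * renyi_divergence \<alpha> Q (P \<theta>) (P \<theta>\<^sub>0)"
  using n \<alpha> unfolding laplace_eq[OF \<theta>] renyi_divergence_eq[OF \<theta>]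
  by (cases "eln (affinity \<theta>)") (auto simp: eln_power)

lemma renyi_divergence_nonneg:
  assumes \<theta>: "\<theta> \<in> space T"
  shows "0 \<le> renyi_divergence \<alpha> Q (P \<theta>) (P \<theta>\<^sub>0)"
proof -
  have "affinity \<theta> < \<top>" using affinity_le_1[OF \<theta>] by (auto intro: le_less_trans)
  moreover have "enn2real (affinity \<theta>) \<le> 1" using affinity_le_1[OF \<theta>] by (intro enn2real_leI) auto
  ultimately have "0 \<le> - eln (affinity \<theta>)"
    by (auto simp: eln_def ln_le_zero_iff zero_less_iff_neq_zero enn2real_positive_iff)
  then show ?thesis
    unfolding renyi_divergence_eq[OF \<theta>] using \<alpha> by (intro ereal_0_le_mult) auto
qed

section \<open>Expectations over the sample\<close>

text \<open>From t \<le> exp t at t = - \<alpha> r, the negative part is dominated by the weight,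
  whose expectation \<open>laplace \<theta>\<close> is at most one.\<close>

lemma llr_neg_part:
  assumes \<theta>: "\<theta> \<in> space T"
  shows "ennreal \<alpha> * (\<integral>\<^sup>+x. e2ennreal (- llr \<theta> x) \<partial>sample) \<le> 1"
proof -
  note [measurable] = llr_measurable_sample[OF \<theta>]
  have "ennreal \<alpha> * (\<integral>\<^sup>+x. e2ennreal (- llr \<theta> x) \<partial>sample) =
      (\<integral>\<^sup>+x. ennreal \<alpha> * e2ennreal (- llr \<theta> x) \<partial>sample)"
    by (rule nn_integral_cmult[symmetric]) measurable
  also have "\<dots> \<le> laplace \<theta>"
    unfolding laplace_def
  proof (rule nn_integral_mono_AE)
    show "AE x in sample. ennreal \<alpha> * e2ennreal (- llr \<theta> x) \<le> exp_neg \<alpha> (llr \<theta> x)"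
      using AE_p\<^sub>0_pos
    proof eventually_elim
      case (elim x)
      then have "llr \<theta> x \<noteq> -\<infinity>" using llr_neq_MInf[OF _ _ \<theta>] by blast
      moreover have "- (\<alpha> * r) \<le> exp (- (\<alpha> * r))" for r
        using exp_ge_add_one_self[of "- (\<alpha> * r)"] by linarith
      ultimately show ?case
        using \<alpha> by (cases "llr \<theta> x") (auto simp: exp_neg_def e2ennreal_neg ennreal_leI simp flip: ennreal_mult')
    qed
  qed
  also have "\<dots> \<le> 1" by (rule laplace_le_1[OF \<theta>])
  finally show ?thesis .
qed

text \<open>When the divergence is finite, the log-likelihood ratio is almost surely a sum of n
  integrable terms, each with mean the divergence. When it is infinite, n \<ge> 1 makes the right
  side \<infinity>. The subtraction on the left is truncated at \<open>0\<close>.\<close>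

lemma llr_expectation_le:
  assumes \<theta>: "\<theta> \<in> space T"
  shows "(\<integral>\<^sup>+x. e2ennreal (llr \<theta> x) \<partial>sample) - (\<integral>\<^sup>+x. e2ennreal (- llr \<theta> x) \<partial>sample)
    \<le> of_nat n * e2ennreal (KL (P \<theta>\<^sub>0) (P \<theta>))"
proof (cases "KL (P \<theta>\<^sub>0) (P \<theta>) = \<infinity>")
  case True
  then show ?thesis using n by (simp add: ennreal_mult_top)
next
  case False
  have s[measurable_cong]: "sets (P \<theta>\<^sub>0) = sets Q" "sets (P \<theta>) = sets Q" using sets_P \<theta> \<theta>\<^sub>0 by auto
  note [measurable] = p_measurable[OF \<theta>] p_measurable[OF \<theta>\<^sub>0]
  obtain f where f: "f \<in> borel_measurable (P \<theta>)" and d: "P \<theta>\<^sub>0 = density (P \<theta>) (\<lambda>x. ennreal (f x))"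
    and pos: "AE x in P \<theta>\<^sub>0. 0 < f x" and int: "integrable (P \<theta>\<^sub>0) (\<lambda>x. ln (f x))"
    and KL: "KL (P \<theta>\<^sub>0) (P \<theta>) = ereal (\<integral>x. ln (f x) \<partial>P \<theta>\<^sub>0)"
    using KL_finiteE[OF prob_P[OF \<theta>] P0.prob_space_axioms _ False] s by auto
  have [measurable]: "f \<in> borel_measurable Q" using f by measurable
  \<comment> \<open>Chain rule for densities. Uniqueness with respect to \<open>Q\<close> is
    available because the density at \<open>\<theta>\<^sub>0\<close> has finite integral.\<close>
  have "density Q (\<lambda>x. ennreal (p \<theta>\<^sub>0 x)) = density Q (\<lambda>x. ennreal (p \<theta> x) * ennreal (f x))"
    using d unfolding P_eq[OF \<theta>] P_eq[OF \<theta>\<^sub>0] by (simp add: density_density_eq)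
  then have "AE x in Q. ennreal (p \<theta>\<^sub>0 x) = ennreal (p \<theta> x) * ennreal (f x)"
    by (subst (asm) finite_density_unique) (auto simp: nn_integral_p \<theta>\<^sub>0)
  then have "AE x in P \<theta>\<^sub>0. 0 < p \<theta>\<^sub>0 x \<and> ennreal (p \<theta>\<^sub>0 x) = ennreal (p \<theta> x) * ennreal (f x)"
    unfolding P_eq[OF \<theta>\<^sub>0] by (subst AE_density) auto
  then have eq: "AE y in P \<theta>\<^sub>0. eln (ennreal (p \<theta>\<^sub>0 y) / ennreal (p \<theta> y)) = ereal (ln (f y))"
    using pos
  proof eventually_elim
    case (elim y)
    then have "ennreal (p \<theta> y) * ennreal (f y) \<noteq> 0" by (metis ennreal_eq_0_iff not_le)
    then have p: "0 < p \<theta> y" "0 < f y" using elim by (auto simp: ennreal_eq_0_iff not_le)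
    then have "ennreal (p \<theta>\<^sub>0 y) = ennreal (p \<theta> y * f y)" using elim by (simp add: ennreal_mult)
    then have "p \<theta>\<^sub>0 y = p \<theta> y * f y" using elim p by (subst (asm) ennreal_inj) auto
    then show ?case using p by (simp add: eln_def divide_ennreal)
  qed
  have "AE x in sample. \<forall>i\<in>{1..n}. eln (ennreal (p \<theta>\<^sub>0 (x i)) / ennreal (p \<theta> (x i))) = ereal (ln (f (x i)))"
    using eq by (intro AE_finite_allI AE_PiM_component prob_P \<theta>\<^sub>0) auto
  then have llr: "AE x in sample. llr \<theta> x = ereal (\<Sum>i=1..n. ln (f (x i)))"
    unfolding log_lik_ratio_def by eventually_elim simp
  have comp: "integrable sample (\<lambda>x. ln (f (x i)))" "(\<integral>x. ln (f (x i)) \<partial>sample) = (\<integral>y. ln (f y) \<partial>P \<theta>\<^sub>0)"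
    if i: "i \<in> {1..n}" for i
  proof -
    have D: "distr sample (P \<theta>\<^sub>0) (\<lambda>x. x i) = P \<theta>\<^sub>0"
      using distr_PiM_component[OF _ i, of "\<lambda>_. P \<theta>\<^sub>0"] prob_P \<theta>\<^sub>0 by simp
    have m: "(\<lambda>x. x i) \<in> measurable sample (P \<theta>\<^sub>0)"
      by (rule measurable_component_singleton[OF i])
    show "integrable sample (\<lambda>x. ln (f (x i)))"
      using int by (intro integrable_distr[OF m]) (simp only: D)
    show "(\<integral>x. ln (f (x i)) \<partial>sample) = (\<integral>y. ln (f y) \<partial>P \<theta>\<^sub>0)"
      using integral_distr[OF m, of "\<lambda>y. ln (f y)"] unfolding D by simp
  qed
  have iS: "integrable sample (\<lambda>x. \<Sum>i=1..n. ln (f (x i)))"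
    using comp(1) by (rule Bochner_Integration.integrable_sum)
  have "(\<integral>x. (\<Sum>i=1..n. ln (f (x i))) \<partial>sample) = (\<Sum>i=1..n. \<integral>x. ln (f (x i)) \<partial>sample)"
    using comp(1) by (rule Bochner_Integration.integral_sum)
  also have "\<dots> = (\<Sum>i=1..n. \<integral>y. ln (f y) \<partial>P \<theta>\<^sub>0)"
    using comp(2) by (rule sum.cong[OF refl])
  finally have "(\<integral>x. (\<Sum>i=1..n. ln (f (x i))) \<partial>sample) = real n * (\<integral>y. ln (f y) \<partial>P \<theta>\<^sub>0)" by simp
  then have e: "eintegral sample (llr \<theta>) = ereal (real n * (\<integral>y. ln (f y) \<partial>P \<theta>\<^sub>0))"
    using eintegral_eq_integral(1)[OF iS llr] by simp
  obtain a b where ab: "(\<integral>\<^sup>+x. e2ennreal (llr \<theta> x) \<partial>sample) = ennreal a" "0 \<le> a"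
      "(\<integral>\<^sup>+x. e2ennreal (- llr \<theta> x) \<partial>sample) = ennreal b" "0 \<le> b"
    using eintegral_eq_integral(2,3)[OF iS llr] by (auto simp: less_top_ennreal)
  have "a - b = real n * (\<integral>y. ln (f y) \<partial>P \<theta>\<^sub>0)"
    using e ab by (simp add: eintegral_def)
  then show ?thesis
    using ab by (simp add: KL ennreal_minus ennreal_mult' ennreal_of_nat_eq_real_of_nat)
qed

lemma Fubini_sample:
  assumes \<rho>: "prob_space \<rho>" "sets \<rho> = sets T"
    and [measurable]: "(\<lambda>(x, \<theta>). f x \<theta>) \<in> borel_measurable (sample \<Otimes>\<^sub>M T)"
  shows "(\<integral>\<^sup>+x. \<integral>\<^sup>+\<theta>. f x \<theta> \<partial>\<rho> \<partial>sample) = (\<integral>\<^sup>+\<theta>. \<integral>\<^sup>+x. f x \<theta> \<partial>sample \<partial>\<rho>)"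
    and "(\<lambda>x. \<integral>\<^sup>+\<theta>. f x \<theta> \<partial>\<rho>) \<in> borel_measurable sample"
    and "(\<lambda>\<theta>. \<integral>\<^sup>+x. f x \<theta> \<partial>sample) \<in> borel_measurable \<rho>"
proof -
  interpret \<rho>: prob_space \<rho> by (rule \<rho>(1))
  interpret pair_sigma_finite sample \<rho> ..
  have [measurable_cong]: "sets \<rho> = sets T" by (rule \<rho>(2))
  have m: "case_prod f \<in> borel_measurable (sample \<Otimes>\<^sub>M \<rho>)"
    by measurable
  show "(\<integral>\<^sup>+x. \<integral>\<^sup>+\<theta>. f x \<theta> \<partial>\<rho> \<partial>sample) = (\<integral>\<^sup>+\<theta>. \<integral>\<^sup>+x. f x \<theta> \<partial>sample \<partial>\<rho>)"
    using Fubini'[OF m] by simp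
  show "(\<lambda>x. \<integral>\<^sup>+\<theta>. f x \<theta> \<partial>\<rho>) \<in> borel_measurable sample"
    using m by (rule \<rho>.borel_measurable_nn_integral)
  have "(\<lambda>(\<theta>, x). f x \<theta>) \<in> borel_measurable (\<rho> \<Otimes>\<^sub>M sample)"
    using measurable_pair_swap[OF m] by (simp add: case_prod_beta')
  then show "(\<lambda>\<theta>. \<integral>\<^sup>+x. f x \<theta> \<partial>sample) \<in> borel_measurable \<rho>"
    by (rule sample.borel_measurable_nn_integral)
qed

text \<open>Only an inequality: where \<open>laplace \<theta>\<close> is \<open>0\<close>, its
  product with its inverse is \<open>0\<close> instead of \<open>1\<close>.\<close>

lemma evidence_integral_le:
  assumes \<pi>: "prob_space \<pi>" "sets \<pi> = sets T"
  shows "(\<integral>\<^sup>+x. \<integral>\<^sup>+\<theta>. exp_neg \<alpha> (llr \<theta> x) * inverse (laplace \<theta>) \<partial>\<pi> \<partial>sample) \<le> 1"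
    and "(\<lambda>x. \<integral>\<^sup>+\<theta>. exp_neg \<alpha> (llr \<theta> x) * inverse (laplace \<theta>) \<partial>\<pi>) \<in> borel_measurable sample"
proof -
  interpret \<pi>: prob_space \<pi> by (rule \<pi>(1))
  note [measurable] = llr_measurable laplace_measurable
  have m: "(\<lambda>(x, \<theta>). exp_neg \<alpha> (llr \<theta> x) * inverse (laplace \<theta>)) \<in> borel_measurable (sample \<Otimes>\<^sub>M T)"
    by measurable
  note F = Fubini_sample[OF \<pi> m]
  show "(\<lambda>x. \<integral>\<^sup>+\<theta>. exp_neg \<alpha> (llr \<theta> x) * inverse (laplace \<theta>) \<partial>\<pi>) \<in> borel_measurable sample"
    by (rule F(2))
  have "(\<integral>\<^sup>+\<theta>. \<integral>\<^sup>+x. exp_neg \<alpha> (llr \<theta> x) * inverse (laplace \<theta>) \<partial>sample \<partial>\<pi>) \<le> (\<integral>\<^sup>+\<theta>. 1 \<partial>\<pi>)"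
  proof (rule nn_integral_mono)
    fix \<theta> assume "\<theta> \<in> space \<pi>"
    then have \<theta>: "\<theta> \<in> space T" using sets_eq_imp_space_eq[OF \<pi>(2)] by simp
    have mE: "(\<lambda>x. exp_neg \<alpha> (llr \<theta> x)) \<in> borel_measurable sample"
      using llr_measurable_sample[OF \<theta>] by measurable
    have "(\<integral>\<^sup>+x. exp_neg \<alpha> (llr \<theta> x) * inverse (laplace \<theta>) \<partial>sample) = laplace \<theta> * inverse (laplace \<theta>)"
      unfolding nn_integral_multc[OF mE] by (simp only: laplace_def)
    also have "\<dots> \<le> 1"
      by (cases "laplace \<theta> = 0 \<or> laplace \<theta> = \<top>")
        (auto simp: ennreal_divide_self less_top simp flip: divide_ennreal_def)
    finally show "(\<integral>\<^sup>+x. exp_neg \<alpha> (llr \<theta> x) * inverse (laplace \<theta>) \<partial>sample) \<le> 1" .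
  qed
  then show "(\<integral>\<^sup>+x. \<integral>\<^sup>+\<theta>. exp_neg \<alpha> (llr \<theta> x) * inverse (laplace \<theta>) \<partial>\<pi> \<partial>sample) \<le> 1"
    unfolding F(1) by (simp add: \<pi>.emeasure_space_1)
qed

lemma expected_llr_le:
  assumes \<rho>: "prob_space \<rho>" "sets \<rho> = sets T"
  defines "L \<equiv> \<integral>\<^sup>+\<theta>. e2ennreal (KL (P \<theta>\<^sub>0) (P \<theta>)) \<partial>\<rho>"
  shows "(\<integral>\<^sup>+x. \<integral>\<^sup>+\<theta>. e2ennreal (llr \<theta> x) \<partial>\<rho> \<partial>sample)
      \<le> of_nat n * L + (\<integral>\<^sup>+x. \<integral>\<^sup>+\<theta>. e2ennreal (- llr \<theta> x) \<partial>\<rho> \<partial>sample)"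
    and "ennreal \<alpha> * (\<integral>\<^sup>+x. \<integral>\<^sup>+\<theta>. e2ennreal (- llr \<theta> x) \<partial>\<rho> \<partial>sample) \<le> 1"
proof -
  interpret \<rho>: prob_space \<rho> by (rule \<rho>(1))
  have sp: "space \<rho> = space T" using \<rho>(2) by (rule sets_eq_imp_space_eq)
  note [measurable] = llr_measurable
  have mp: "(\<lambda>(x, \<theta>). e2ennreal (llr \<theta> x)) \<in> borel_measurable (sample \<Otimes>\<^sub>M T)"
    and mn: "(\<lambda>(x, \<theta>). e2ennreal (- llr \<theta> x)) \<in> borel_measurable (sample \<Otimes>\<^sub>M T)"
    by measurable
  note Fp = Fubini_sample[OF \<rho> mp] and Fn = Fubini_sample[OF \<rho> mn]
  note [measurable] = Fp(3) Fn(3)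
  let ?K\<^sub>p = "\<lambda>\<theta>. \<integral>\<^sup>+x. e2ennreal (llr \<theta> x) \<partial>sample"
  let ?K\<^sub>n = "\<lambda>\<theta>. \<integral>\<^sup>+x. e2ennreal (- llr \<theta> x) \<partial>sample"
  have "of_nat n \<noteq> (0 :: ennreal)" "of_nat n < (\<top> :: ennreal)"
    using n by (auto simp: of_nat_less_top)
  then have n0: "of_nat n * inverse (of_nat n :: ennreal) = 1"
    using ennreal_divide_self by (simp flip: divide_ennreal_def)
  \<comment> \<open>The divergence may fail to be measurable in \<theta>, so n cannot be pulled out
    of its integral. It is pulled out of the measurable left side instead, after which only
    monotonicity touches the divergence.\<close>
  have "(\<integral>\<^sup>+\<theta>. ?K\<^sub>p \<theta> - ?K\<^sub>n \<theta> \<partial>\<rho>) = of_nat n * (\<integral>\<^sup>+\<theta>. inverse (of_nat n) * (?K\<^sub>p \<theta> - ?K\<^sub>n \<theta>) \<partial>\<rho>)"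
    by (subst nn_integral_cmult) (auto simp: n0 simp flip: mult.assoc)
  also have "\<dots> \<le> of_nat n * L"
    unfolding L_def
  proof (intro mult_left_mono nn_integral_mono)
    fix \<theta> assume "\<theta> \<in> space \<rho>"
    then have "inverse (of_nat n) * (?K\<^sub>p \<theta> - ?K\<^sub>n \<theta>)
        \<le> inverse (of_nat n) * (of_nat n * e2ennreal (KL (P \<theta>\<^sub>0) (P \<theta>)))"
      using llr_expectation_le by (intro mult_left_mono) (auto simp: sp)
    also have "\<dots> = e2ennreal (KL (P \<theta>\<^sub>0) (P \<theta>))"
      using n0 by (metis mult.assoc mult.commute mult_1)
    finally show "inverse (of_nat n) * (?K\<^sub>p \<theta> - ?K\<^sub>n \<theta>) \<le> e2ennreal (KL (P \<theta>\<^sub>0) (P \<theta>))" .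
  qed simp
  finally have diff: "(\<integral>\<^sup>+\<theta>. ?K\<^sub>p \<theta> - ?K\<^sub>n \<theta> \<partial>\<rho>) \<le> of_nat n * L" .
  \<comment> \<open>Adding the negative part back to a truncated difference gives at least the
    positive part, so no case distinction on finiteness is needed before integrating.\<close>
  have "(\<integral>\<^sup>+\<theta>. ?K\<^sub>p \<theta> \<partial>\<rho>) \<le> (\<integral>\<^sup>+\<theta>. (?K\<^sub>p \<theta> - ?K\<^sub>n \<theta>) + ?K\<^sub>n \<theta> \<partial>\<rho>)"
  proof (rule nn_integral_mono)
    fix \<theta>
    show "?K\<^sub>p \<theta> \<le> (?K\<^sub>p \<theta> - ?K\<^sub>n \<theta>) + ?K\<^sub>n \<theta>"
      by (cases "?K\<^sub>n \<theta> \<le> ?K\<^sub>p \<theta>")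
        (auto simp: diff_add_cancel_ennreal not_le intro: order_trans[OF less_imp_le] add_increasing)
  qed
  also have "\<dots> = (\<integral>\<^sup>+\<theta>. ?K\<^sub>p \<theta> - ?K\<^sub>n \<theta> \<partial>\<rho>) + (\<integral>\<^sup>+\<theta>. ?K\<^sub>n \<theta> \<partial>\<rho>)"
    by (rule nn_integral_add) measurable
  also have "\<dots> \<le> of_nat n * L + (\<integral>\<^sup>+\<theta>. ?K\<^sub>n \<theta> \<partial>\<rho>)"
    using diff by (rule add_right_mono)
  finally show "(\<integral>\<^sup>+x. \<integral>\<^sup>+\<theta>. e2ennreal (llr \<theta> x) \<partial>\<rho> \<partial>sample)
      \<le> of_nat n * L + (\<integral>\<^sup>+x. \<integral>\<^sup>+\<theta>. e2ennreal (- llr \<theta> x) \<partial>\<rho> \<partial>sample)"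
    by (simp only: Fp(1) Fn(1))
  have "ennreal \<alpha> * (\<integral>\<^sup>+\<theta>. ?K\<^sub>n \<theta> \<partial>\<rho>) = (\<integral>\<^sup>+\<theta>. ennreal \<alpha> * ?K\<^sub>n \<theta> \<partial>\<rho>)"
    by (rule nn_integral_cmult[symmetric]) measurable
  also have "\<dots> \<le> (\<integral>\<^sup>+\<theta>. 1 \<partial>\<rho>)"
    using llr_neg_part by (intro nn_integral_mono) (simp add: sp)
  also have "\<dots> = 1" by (simp add: \<rho>.emeasure_space_1)
  finally show "ennreal \<alpha> * (\<integral>\<^sup>+x. \<integral>\<^sup>+\<theta>. e2ennreal (- llr \<theta> x) \<partial>\<rho> \<partial>sample) \<le> 1"
    by (simp only: Fn(1))
qed

section \<open>Integrated divergences and the bound for a fixed competitor\<close>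

lemma eintegral_KL:
  assumes \<rho>: "sets \<rho> = sets T"
  shows "eintegral \<rho> (\<lambda>\<theta>. KL (P \<theta>\<^sub>0) (P \<theta>)) = enn2ereal (\<integral>\<^sup>+\<theta>. e2ennreal (KL (P \<theta>\<^sub>0) (P \<theta>)) \<partial>\<rho>)"
proof -
  have "0 \<le> KL (P \<theta>\<^sub>0) (P \<theta>)" if "\<theta> \<in> space \<rho>" for \<theta>
    using that sets_eq_imp_space_eq[OF \<rho>] \<theta>\<^sub>0
    by (intro KL_nonneg prob_P) (auto simp: sets_P)
  then have "(\<integral>\<^sup>+\<theta>. e2ennreal (- KL (P \<theta>\<^sub>0) (P \<theta>)) \<partial>\<rho>) = (\<integral>\<^sup>+\<theta>. 0 \<partial>\<rho>)"
    by (intro nn_integral_cong) (simp add: e2ennreal_neg)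
  then show ?thesis by (simp add: eintegral_def zero_ennreal.rep_eq)
qed

lemma eintegral_renyi:
  assumes \<rho>: "sets \<rho> = sets T"
  shows "(\<integral>\<^sup>+\<theta>. e2ennreal (- eln (laplace \<theta>)) \<partial>\<rho>) =
    ennreal (real n * (1 - \<alpha>)) * e2ennreal (eintegral \<rho> (\<lambda>\<theta>. renyi_divergence \<alpha> Q (P \<theta>) (P \<theta>\<^sub>0)))"
proof -
  let ?D = "\<lambda>\<theta>. renyi_divergence \<alpha> Q (P \<theta>) (P \<theta>\<^sub>0)"
  have sp: "space \<rho> = space T" using \<rho> by (rule sets_eq_imp_space_eq)
  have [measurable_cong]: "sets \<rho> = sets T" by fact
  note [measurable] = laplace_measurable
  have c: "0 < real n * (1 - \<alpha>)" using n \<alpha> by simp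
  have eq: "e2ennreal (- eln (laplace \<theta>)) = ennreal (real n * (1 - \<alpha>)) * e2ennreal (?D \<theta>)"
    if "\<theta> \<in> space \<rho>" for \<theta>
    using that c renyi_divergence_nonneg[of \<theta>] unfolding sp
    by (cases "?D \<theta>") (simp_all add: renyi_divergence_laplace ennreal_mult ennreal_mult_top)
  have inv: "ennreal (1 / (real n * (1 - \<alpha>))) * ennreal (real n * (1 - \<alpha>)) = 1"
    using n \<alpha> by (subst ennreal_mult[symmetric]) auto
  \<comment> \<open>The relation is inverted so that the divergence inherits measurability in
    \<theta> from \<open>laplace\<close>.\<close>
  have D: "e2ennreal (?D \<theta>) = ennreal (1 / (real n * (1 - \<alpha>))) * e2ennreal (- eln (laplace \<theta>))"
    if "\<theta> \<in> space \<rho>" for \<theta>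
    unfolding eq[OF that] mult.assoc[symmetric] inv by simp
  have m: "(\<lambda>\<theta>. e2ennreal (?D \<theta>)) \<in> borel_measurable \<rho>"
    by (subst measurable_cong[OF D]) auto
  have "(\<integral>\<^sup>+\<theta>. e2ennreal (- ?D \<theta>) \<partial>\<rho>) = (\<integral>\<^sup>+\<theta>. 0 \<partial>\<rho>)"
    using renyi_divergence_nonneg by (intro nn_integral_cong) (simp add: e2ennreal_neg sp)
  then have "eintegral \<rho> ?D = enn2ereal (\<integral>\<^sup>+\<theta>. e2ennreal (?D \<theta>) \<partial>\<rho>)"
    by (simp add: eintegral_def zero_ennreal.rep_eq)
  moreover have "(\<integral>\<^sup>+\<theta>. e2ennreal (- eln (laplace \<theta>)) \<partial>\<rho>) =
      (\<integral>\<^sup>+\<theta>. ennreal (real n * (1 - \<alpha>)) * e2ennreal (?D \<theta>) \<partial>\<rho>)"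
    by (rule nn_integral_cong) (rule eq)
  ultimately show ?thesis using m by (simp add: nn_integral_cmult)
qed

text \<open>The pathwise inequality, averaged over the sample with a competitor
  \<open>\<rho>\<close> that does not depend on the data. The infimum can therefore be taken
  afterwards, outside the expectation.\<close>

lemma expected_renyi_le:
  assumes \<pi>: "\<pi> \<in> space (prob_algebra T)" and F: "F \<subseteq> space (prob_algebra T)" and \<rho>: "\<rho> \<in> F"
    and min: "AE x in sample. variational_approximation n \<alpha> p \<theta>\<^sub>0 \<pi> F x (\<pi>\<^sub>v x)"
    and meas: "(\<lambda>x. eintegral (\<pi>\<^sub>v x) (\<lambda>\<theta>. renyi_divergence \<alpha> Q (P \<theta>) (P \<theta>\<^sub>0))) \<in> borel_measurable sample"
  shows "eintegral sample (\<lambda>x. eintegral (\<pi>\<^sub>v x) (\<lambda>\<theta>. renyi_divergence \<alpha> Q (P \<theta>) (P \<theta>\<^sub>0)))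
    \<le> ereal (\<alpha> / (1 - \<alpha>)) * eintegral \<rho> (\<lambda>\<theta>. KL (P \<theta>\<^sub>0) (P \<theta>)) + KL \<rho> \<pi> / ereal (real n * (1 - \<alpha>))"
    (is "?lhs \<le> ?rhs")
proof -
  have \<pi>': "prob_space \<pi>" "sets \<pi> = sets T" using \<pi> by (auto simp: space_prob_algebra)
  have F': "prob_space \<nu>" "sets \<nu> = sets T" if "\<nu> \<in> F" for \<nu>
    using that F by (auto simp: space_prob_algebra)
  have sp: "space \<pi> = space T" using \<pi>'(2) by (rule sets_eq_imp_space_eq)
  have c: "0 < real n * (1 - \<alpha>)" using n \<alpha> by simp
  define L where "L = (\<integral>\<^sup>+\<theta>. e2ennreal (KL (P \<theta>\<^sub>0) (P \<theta>)) \<partial>\<rho>)"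
  have eL: "eintegral \<rho> (\<lambda>\<theta>. KL (P \<theta>\<^sub>0) (P \<theta>)) = enn2ereal L"
    unfolding L_def by (rule eintegral_KL[OF F'(2)[OF \<rho>]])
  have KL0: "0 \<le> KL \<rho> \<pi>"
    using KL_nonneg[OF \<pi>'(1) F'(1)[OF \<rho>]] F'(2)[OF \<rho>] \<pi>'(2) by simp
  show ?thesis
  \<comment> \<open>An infinite term on the right leaves nothing to prove. Otherwise both terms are
    finite and the last computation takes place in the reals.\<close>
  proof (cases "L = \<top> \<or> KL \<rho> \<pi> = \<infinity>")
    case True
    then have "ereal (\<alpha> / (1 - \<alpha>)) * eintegral \<rho> (\<lambda>\<theta>. KL (P \<theta>\<^sub>0) (P \<theta>)) = \<infinity> \<or>
        KL \<rho> \<pi> / ereal (real n * (1 - \<alpha>)) = \<infinity>"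
      using \<alpha> c by (auto simp: eL top_ennreal.rep_eq top_ereal_def)
    then have "?rhs = \<infinity>" by auto
    then show ?thesis by (simp only: ereal_less_eq(1))
  next
    case False
    define l where "l = enn2real L"
    have l: "L = ennreal l" "0 \<le> l" using False by (simp_all add: l_def less_top)
    define k where "k = real_of_ereal (KL \<rho> \<pi>)"
    have k: "KL \<rho> \<pi> = ereal k" "0 \<le> k" using False KL0 by (cases "KL \<rho> \<pi>"; simp add: k_def)+
    let ?N = "\<lambda>x. \<integral>\<^sup>+\<theta>. e2ennreal (- llr \<theta> x) \<partial>\<rho>" and ?p = "\<lambda>x. \<integral>\<^sup>+\<theta>. e2ennreal (llr \<theta> x) \<partial>\<rho>"
    let ?Y = "\<lambda>x. \<integral>\<^sup>+\<theta>. exp_neg \<alpha> (llr \<theta> x) * inverse (laplace \<theta>) \<partial>\<pi>"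
    let ?H = "\<lambda>x. e2ennreal (eintegral (\<pi>\<^sub>v x) (\<lambda>\<theta>. renyi_divergence \<alpha> Q (P \<theta>) (P \<theta>\<^sub>0)))"
    note [measurable] = llr_measurable meas evidence_integral_le(2)[OF \<pi>']
    have mp[measurable]: "?p \<in> borel_measurable sample" and mn[measurable]: "?N \<in> borel_measurable sample"
      by (intro Fubini_sample(2) F' \<rho>; measurable)+
    note N1 = expected_llr_le(2)[OF F'[OF \<rho>]]
    define b where "b = enn2real (\<integral>\<^sup>+x. ?N x \<partial>sample)"
    have "(\<integral>\<^sup>+x. ?N x \<partial>sample) < \<top>"
      using N1 \<alpha> by (auto simp: less_top[symmetric] ennreal_mult_top top_unique)
    then have b: "(\<integral>\<^sup>+x. ?N x \<partial>sample) = ennreal b" "0 \<le> b"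
      by (simp_all add: b_def)
    have p_le: "(\<integral>\<^sup>+x. ?p x \<partial>sample) \<le> ennreal (real n * l + b)"
      using expected_llr_le(1)[OF F'[OF \<rho>]] l b
      by (simp add: L_def[symmetric] ennreal_mult ennreal_of_nat_eq_real_of_nat)
    have "AE x in sample. ?p x \<noteq> \<infinity>"
      using p_le by (intro nn_integral_PInf_AE) (auto simp: top_unique)
    moreover have "AE x in sample. ?Y x \<noteq> \<infinity>"
      using evidence_integral_le(1)[OF \<pi>'] by (intro nn_integral_PInf_AE) (auto simp: top_unique)
    ultimately have main: "AE x in sample.
        ennreal (real n * (1 - \<alpha>)) * ?H x + ennreal \<alpha> * ?N x + 1 \<le> ennreal \<alpha> * ?p x + e2ennreal (KL \<rho> \<pi>) + ?Y x"
      using AE_p\<^sub>0_pos min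
    proof eventually_elim
      case (elim x)
      then have x: "x \<in> space sample" "\<forall>i\<in>{1..n}. 0 < p \<theta>\<^sub>0 (x i)" by auto
      have [measurable_cong]: "sets \<pi> = sets T" by (rule \<pi>'(2))
      have mG: "(\<lambda>\<theta>. llr \<theta> x) \<in> borel_measurable \<pi>" "laplace \<in> borel_measurable \<pi>"
        using llr_measurable_param[OF x(1)] laplace_measurable by measurable
      have "?p x < \<infinity>" using elim by (simp add: less_top)
      then have "eintegral \<rho> (\<lambda>\<theta>. llr \<theta> x) \<noteq> \<infinity>"
        unfolding eintegral_def by (cases "?p x"; cases "?N x") (auto simp: enn2ereal_ennreal)
      moreover have "\<pi>\<^sub>v x \<in> F" using elim by (auto simp: variational_approximation_def is_arg_min_def)
      ultimately show ?case
        unfolding eintegral_renyi[OF F'(2)[OF \<open>\<pi>\<^sub>v x \<in> F\<close>], symmetric]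
        using elim F' \<pi>' \<rho> k mG laplace_le_1 llr_neq_MInf[OF x] \<alpha>
        by (intro variational_minimiser_bound[where F = F and \<pi> = \<pi>])
          (auto simp: variational_approximation_def tempered_posterior_eq[OF x \<pi>'(2)] sp less_top)
    qed
    define h where "h = (\<integral>\<^sup>+x. ?H x \<partial>sample)"
    have "ennreal (real n * (1 - \<alpha>)) * h + ennreal \<alpha> * ennreal b + 1 =
        (\<integral>\<^sup>+x. ennreal (real n * (1 - \<alpha>)) * ?H x + ennreal \<alpha> * ?N x + 1 \<partial>sample)"
      unfolding h_def b(1)[symmetric]
      by (simp add: nn_integral_add nn_integral_cmult sample.emeasure_space_1)
    also have "\<dots> \<le> (\<integral>\<^sup>+x. ennreal \<alpha> * ?p x + e2ennreal (KL \<rho> \<pi>) + ?Y x \<partial>sample)"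
      using main by (rule nn_integral_mono_AE)
    also have "\<dots> = ennreal \<alpha> * (\<integral>\<^sup>+x. ?p x \<partial>sample) + ennreal k + (\<integral>\<^sup>+x. ?Y x \<partial>sample)"
      by (simp add: nn_integral_add nn_integral_cmult sample.emeasure_space_1 k)
    also have "\<dots> \<le> ennreal \<alpha> * ennreal (real n * l + b) + ennreal k + 1"
      using p_le evidence_integral_le(1)[OF \<pi>'] by (intro add_mono mult_left_mono) auto
    finally have le: "ennreal (real n * (1 - \<alpha>)) * h + ennreal \<alpha> * ennreal b + 1
        \<le> ennreal \<alpha> * ennreal (real n * l + b) + ennreal k + 1" .
    also have "\<dots> < \<top>" by (simp add: ennreal_mult_less_top)
    \<comment> \<open>The averaged inequality itself shows that the expected divergence is finite,
      since its coefficient is positive.\<close>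
    finally have "h \<noteq> \<top>" using n \<alpha> by (auto simp: ennreal_mult_top)
    define r where "r = enn2real h"
    have r: "h = ennreal r" "0 \<le> r" using \<open>h \<noteq> \<top>\<close> by (simp_all add: r_def less_top)
    have "ennreal (real n * (1 - \<alpha>) * r + \<alpha> * b + 1) \<le> ennreal (\<alpha> * (real n * l + b) + k + 1)"
      using le c \<alpha> b(2) l(2) k(2) r by (simp add: ennreal_mult)
    then have "real n * (1 - \<alpha>) * r + \<alpha> * b + 1 \<le> \<alpha> * (real n * l + b) + k + 1"
      using \<alpha> b(2) l(2) k(2) by (subst (asm) ennreal_le_iff) auto
    \<comment> \<open>Here the two copies of \<open>\<alpha> * b\<close> cancel. This requires
      \<open>b\<close>, the expected negative part, to be finite, which is what
      \<open>llr_neg_part\<close> secured.\<close>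
    then have "real n * (1 - \<alpha>) * r \<le> real n * \<alpha> * l + k" by (simp add: algebra_simps)
    then have "r \<le> (real n * \<alpha> * l + k) / (real n * (1 - \<alpha>))"
      using c by (simp add: pos_le_divide_eq mult.commute)
    also have "\<dots> = \<alpha> / (1 - \<alpha>) * l + k / (real n * (1 - \<alpha>))"
      using n \<alpha> by (simp add: add_divide_distrib)
    finally have "ereal r \<le> ?rhs"
      unfolding eL using l k n \<alpha> by (simp add: enn2ereal_ennreal)
    \<comment> \<open>Dropping the subtracted negative part can only increase the outer
      integral.\<close>
    moreover have "?lhs \<le> enn2ereal h"
      unfolding eintegral_def[of sample] h_def[symmetric] by (intro ereal_diff_le_self) simp
    ultimately show ?thesis using r by (simp add: enn2ereal_ennreal)
  qed
qed

end

theorem theorem2p6: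
  fixes Q :: "'a measure"
    and T :: "'t measure"
    and P :: "'t \<Rightarrow> 'a measure"
    and p :: "'t \<Rightarrow> 'a \<Rightarrow> real"
    and \<theta>\<^sub>0 :: 't
    and \<pi> :: "'t measure"
    and F :: "'t measure set"
    and n :: nat
    and \<alpha> :: real
    and \<pi>\<^sub>v :: "(nat \<Rightarrow> 'a) \<Rightarrow> 't measure"
  assumes "\<And>\<theta>. \<theta> \<in> space T \<Longrightarrow> prob_space (P \<theta>)"
    and "\<And>\<theta>. \<theta> \<in> space T \<Longrightarrow> p \<theta> \<in> borel_measurable Q"
    and "\<And>\<theta> x. \<theta> \<in> space T \<Longrightarrow> x \<in> space Q \<Longrightarrow> 0 \<le> p \<theta> x"
    and "\<And>\<theta>. \<theta> \<in> space T \<Longrightarrow> P \<theta> = density Q (\<lambda>x. ennreal (p \<theta> x))"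
    and "\<theta>\<^sub>0 \<in> space T"
    and "\<pi> \<in> space (prob_algebra T)"
    and "F \<subseteq> space (prob_algebra T)"
    and "1 \<le> n"
    and "0 < \<alpha>" and "\<alpha> < 1"
    and "(\<lambda>(x, \<theta>). log_lik_ratio n p \<theta> \<theta>\<^sub>0 x)
           \<in> borel_measurable (Pi\<^sub>M {1..n} (\<lambda>_. P \<theta>\<^sub>0) \<Otimes>\<^sub>M T)"
    and "AE x in Pi\<^sub>M {1..n} (\<lambda>_. P \<theta>\<^sub>0).
           variational_approximation n \<alpha> p \<theta>\<^sub>0 \<pi> F x (\<pi>\<^sub>v x)"
    and "(\<lambda>x. eintegral (\<pi>\<^sub>v x) (\<lambda>\<theta>. renyi_divergence \<alpha> Q (P \<theta>) (P \<theta>\<^sub>0)))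
           \<in> borel_measurable (Pi\<^sub>M {1..n} (\<lambda>_. P \<theta>\<^sub>0))"
  shows "eintegral (Pi\<^sub>M {1..n} (\<lambda>_. P \<theta>\<^sub>0))
             (\<lambda>x. eintegral (\<pi>\<^sub>v x) (\<lambda>\<theta>. renyi_divergence \<alpha> Q (P \<theta>) (P \<theta>\<^sub>0)))
           \<le> (INF \<rho>\<in>F. ereal (\<alpha> / (1 - \<alpha>)) * eintegral \<rho> (\<lambda>\<theta>. KL (P \<theta>\<^sub>0) (P \<theta>))
                        + KL \<rho> \<pi> / ereal (real n * (1 - \<alpha>)))
         \<and> (\<forall>\<epsilon>::real. 0 < \<epsilon> \<and>
               (\<exists>\<rho>\<in>F. eintegral \<rho> (\<lambda>\<theta>. KL (P \<theta>\<^sub>0) (P \<theta>)) \<le> ereal \<epsilon> \<and>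
                       KL \<rho> \<pi> \<le> ereal (real n * \<epsilon>)) \<longrightarrow>
             eintegral (Pi\<^sub>M {1..n} (\<lambda>_. P \<theta>\<^sub>0))
               (\<lambda>x. eintegral (\<pi>\<^sub>v x) (\<lambda>\<theta>. renyi_divergence \<alpha> Q (P \<theta>) (P \<theta>\<^sub>0)))
             \<le> ereal ((1 + \<alpha>) / (1 - \<alpha>) * \<epsilon>))"
proof -
  interpret dominated_model Q T P p \<theta>\<^sub>0 n \<alpha>
    by (rule dominated_model.intro) (fact assms)+
  let ?lhs = "eintegral sample (\<lambda>x. eintegral (\<pi>\<^sub>v x) (\<lambda>\<theta>. renyi_divergence \<alpha> Q (P \<theta>) (P \<theta>\<^sub>0)))"
  note bound = expected_renyi_le[OF assms(6,7) _ assms(12,13)]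
  have "?lhs \<le> ereal ((1 + \<alpha>) / (1 - \<alpha>) * \<epsilon>)"
    if \<rho>: "\<rho> \<in> F" "eintegral \<rho> (\<lambda>\<theta>. KL (P \<theta>\<^sub>0) (P \<theta>)) \<le> ereal \<epsilon>" "KL \<rho> \<pi> \<le> ereal (real n * \<epsilon>)"
    for \<rho> \<epsilon>
  proof -
    have c: "0 < real n * (1 - \<alpha>)" using n \<alpha> by simp
    note bound[OF \<rho>(1)]
    also have "ereal (\<alpha> / (1 - \<alpha>)) * eintegral \<rho> (\<lambda>\<theta>. KL (P \<theta>\<^sub>0) (P \<theta>)) + KL \<rho> \<pi> / ereal (real n * (1 - \<alpha>))
        \<le> ereal (\<alpha> / (1 - \<alpha>)) * ereal \<epsilon> + ereal (real n * \<epsilon>) / ereal (real n * (1 - \<alpha>))"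
      using \<rho> \<alpha> c by (intro add_mono ereal_mult_left_mono ereal_divide_right_mono) auto
    also have "\<dots> = ereal ((1 + \<alpha>) / (1 - \<alpha>) * \<epsilon>)"
    proof -
      have "real n * \<epsilon> / (real n * (1 - \<alpha>)) = \<epsilon> / (1 - \<alpha>)" using n by simp
      then show ?thesis using n \<alpha> by (simp add: add_divide_distrib distrib_right)
    qed
    finally show ?thesis .
  qed
  then show ?thesis
    using bound by (blast intro: INF_greatest)
qed

end
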